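(* 1) The number of nonisomorphic types of Wajsberg algebras of order $n$ is $\pi_n$. 2) The total number of Wajsberg algebras of order $n$ is $\pi_n\,(n-2)!+1$, for $n\ge 4$, $n$ not a prime number.
   Context: A Wajsberg algebra is an algebra $(W,\circ,\overline{\phantom{x}},1)$ of type $(2,1,0)$ such that for all $x,y,z\in W$: (i) $1\circ x=x$; (ii) $(x\circ y)\circ[(y\circ z)\circ(x\circ z)]=1$; (iii) $(x\circ y)\circ y=(y\circ x)\circ x$; (iv) $(\overline{x}\circ\overline{y})\circ(y\circ x)=1$. Its order is its number of elements. Write $0=\overline{1}$. The natural order relation on $W$ is: $x\le y$ if and only if $x\circ y=1$. For a positive integer $n$, $\pi_n$ denotes the number of decompositions $n=r_1r_2\cdots r_t$ with $r_i\in\mathbb{N}$ and $1<r_i<n$ for all $i\in\{1,\dots,t\}$, where decompositions with the same factors in a different order are counted only once. To each such decomposition corresponds the direct product (with componentwise operations) of totally ordered Wajsberg algebras of orders $r_1,\dots,r_t$; these products are denoted $\mathcal{W}_i^n$, $i\in\{1,\dots,\pi_n\}$, with operation $\nabla_i$, and they are pairwise nonisomorphic as ordered sets. Counting convention for the total number: for each $i$, one takes the bijections $f$ from $\mathcal{W}_i^n$ to its underlying set that fix the least element and the greatest element, and to each such $f$ one associates the Wajsberg algebra whose operation is defined by transport, $f(a)\nabla f(b):=f(a\,\nabla_i\, b)$; each such $f$ is counted as giving one (partially ordered) Wajsberg algebra. The totally ordered Wajsberg algebra of order $n$ is counted once.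
   Formalization: Part 1 is false as written (for n=4, π_4=1, but the chain and the product of two 2-element chains are two types); proved instead: π_n counts the types of order n that are not totally ordered, and all Wajsberg algebras of order n have π_n+1 types. *)

theory Defs
  imports Main "HOL-Algebra.Congruence" "HOL-Library.Multiset"
    "HOL-Combinatorics.Permutations" "HOL-Computational_Algebra.Primes"
begin

record 'a wajsberg = "'a partial_object" +
  wimp :: "'a \<Rightarrow> 'a \<Rightarrow> 'a" (infixl "\<triangleright>\<index>" 70)
  wneg :: "'a \<Rightarrow> 'a"
  wone :: 'a

locale wajsberg_algebra =
  fixes W :: "'a wajsberg" (structure)
  assumes imp_closed: "\<lbrakk>x \<in> carrier W; y \<in> carrier W\<rbrakk> \<Longrightarrow> x \<triangleright> y \<in> carrier W"
    and neg_closed: "x \<in> carrier W \<Longrightarrow> wneg W x \<in> carrier W"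
    and one_closed: "wone W \<in> carrier W"
    and one_imp: "x \<in> carrier W \<Longrightarrow> wone W \<triangleright> x = x"
    and imp_trans: "\<lbrakk>x \<in> carrier W; y \<in> carrier W; z \<in> carrier W\<rbrakk> \<Longrightarrow>
          (x \<triangleright> y) \<triangleright> ((y \<triangleright> z) \<triangleright> (x \<triangleright> z)) = wone W"
    and imp_comm: "\<lbrakk>x \<in> carrier W; y \<in> carrier W\<rbrakk> \<Longrightarrow> (x \<triangleright> y) \<triangleright> y = (y \<triangleright> x) \<triangleright> x"
    and neg_contr: "\<lbrakk>x \<in> carrier W; y \<in> carrier W\<rbrakk> \<Longrightarrow>
          (wneg W x \<triangleright> wneg W y) \<triangleright> (y \<triangleright> x) = wone W"

definition wle :: "'a wajsberg \<Rightarrow> 'a \<Rightarrow> 'a \<Rightarrow> bool" where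
  "wle W x y \<longleftrightarrow> x \<triangleright>\<^bsub>W\<^esub> y = wone W"

definition wtotal :: "'a wajsberg \<Rightarrow> bool" where
  "wtotal W \<longleftrightarrow> (\<forall>x\<in>carrier W. \<forall>y\<in>carrier W. wle W x y \<or> wle W y x)"

definition wleast :: "'a wajsberg \<Rightarrow> 'a \<Rightarrow> bool" where
  "wleast W x \<longleftrightarrow> x \<in> carrier W \<and> (\<forall>y\<in>carrier W. wle W x y)"

definition wgreatest :: "'a wajsberg \<Rightarrow> 'a \<Rightarrow> bool" where
  "wgreatest W x \<longleftrightarrow> x \<in> carrier W \<and> (\<forall>y\<in>carrier W. wle W y x)"

definition wiso :: "'a wajsberg \<Rightarrow> 'b wajsberg \<Rightarrow> ('a \<Rightarrow> 'b) set" where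
  "wiso V W = {h. bij_betw h (carrier V) (carrier W)
     \<and> (\<forall>x\<in>carrier V. \<forall>y\<in>carrier V. h (x \<triangleright>\<^bsub>V\<^esub> y) = h x \<triangleright>\<^bsub>W\<^esub> h y)
     \<and> (\<forall>x\<in>carrier V. h (wneg V x) = wneg W (h x))
     \<and> h (wone V) = wone W}"

definition wajsberg_algebras :: "nat \<Rightarrow> 'a wajsberg set" where
  "wajsberg_algebras n = {W. wajsberg_algebra W \<and> finite (carrier W) \<and> card (carrier W) = n}"

definition wajsberg_chains :: "nat \<Rightarrow> 'a wajsberg set" where
  "wajsberg_chains n = {W \<in> wajsberg_algebras n. wtotal W}"

definition wajsberg_nonchains :: "nat \<Rightarrow> 'a wajsberg set" where
  "wajsberg_nonchains n = {W \<in> wajsberg_algebras n. \<not> wtotal W}"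

text \<open>
  Isomorphism types are counted among the algebras whose carrier is a set of natural numbers:
  every finite algebra has an isomorphic copy there. Records that differ only outside the
  carrier are isomorphic, so they do not affect the count.
\<close>
definition iso_types :: "nat wajsberg set \<Rightarrow> nat wajsberg set set" where
  "iso_types S = S // {(V, W). V \<in> S \<and> W \<in> S \<and> wiso V W \<noteq> {}}"

text \<open>
  Decompositions up to the order of the factors are multisets. The empty multiset is excluded
  because it would decompose 1.
\<close>
definition decompositions :: "nat \<Rightarrow> nat multiset set" where
  "decompositions n = {R. R \<noteq> {#} \<and> (\<forall>r\<in>#R. 1 < r \<and> r < n) \<and> prod_mset R = n}"

definition num_decompositions :: "nat \<Rightarrow> nat" where
  "num_decompositions n = card (decompositions n)"

definition direct_product :: "'a wajsberg list \<Rightarrow> 'a list wajsberg" where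
  "direct_product Ws =
     \<lparr>carrier = {xs. list_all2 (\<lambda>x W. x \<in> carrier W) xs Ws},
      wimp = (\<lambda>xs ys. map (\<lambda>i. xs ! i \<triangleright>\<^bsub>Ws ! i\<^esub> ys ! i) [0..<length Ws]),
      wneg = (\<lambda>xs. map (\<lambda>i. wneg (Ws ! i) (xs ! i)) [0..<length Ws]),
      wone = map wone Ws\<rparr>"

text \<open>\<open>C r\<close> is the chain of order \<open>r\<close> chosen as a factor.\<close>
definition product_of_chains :: "(nat \<Rightarrow> 'a wajsberg) \<Rightarrow> nat multiset \<Rightarrow> 'a list wajsberg" where
  "product_of_chains C R = direct_product (map C (sorted_list_of_multiset R))"

definition transport :: "('a \<Rightarrow> 'a) \<Rightarrow> 'a wajsberg \<Rightarrow> 'a wajsberg" where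
  "transport f W = (let g = inv_into (carrier W) f in
     \<lparr>carrier = f ` carrier W,
      wimp = (\<lambda>x y. f (g x \<triangleright>\<^bsub>W\<^esub> g y)),
      wneg = (\<lambda>x. f (wneg W (g x))),
      wone = f (wone W)\<rparr>)"

text \<open>
  \<open>permutes\<close> makes a bijection the identity outside the carrier, so that each bijection of the
  carrier is represented by exactly one function.
\<close>
definition relabellings :: "'a wajsberg \<Rightarrow> ('a \<Rightarrow> 'a) set" where
  "relabellings W = {f. f permutes carrier W \<and> (\<forall>x. wleast W x \<or> wgreatest W x \<longrightarrow> f x = x)}"

text \<open>
  One element for each bijection, even when two bijections transport a product to the same
  algebra. That each transported structure is a Wajsberg algebra of order \<open>n\<close> which is not
  totally ordered is a condition for being counted.
\<close>
definition relabelled_products ::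
    "(nat \<Rightarrow> 'a wajsberg) \<Rightarrow> nat \<Rightarrow> (nat multiset \<times> ('a list \<Rightarrow> 'a list)) set" where
  "relabelled_products C n =
     {(R, f). R \<in> decompositions n \<and> f \<in> relabellings (product_of_chains C R)
        \<and> transport f (product_of_chains C R) \<in> wajsberg_nonchains n}"

definition total_number :: "(nat \<Rightarrow> 'a wajsberg) \<Rightarrow> nat \<Rightarrow> nat" where
  "total_number C n = card (relabelled_products C n) + card (iso_types (wajsberg_chains n))"

text \<open>Chains of every positive order exist.\<close>
definition luk_chain :: "nat \<Rightarrow> nat wajsberg" where
  "luk_chain r = \<lparr>carrier = {..<r}, wimp = (\<lambda>x y. min (r - 1) (r - 1 - x + y)),
     wneg = (\<lambda>x. r - 1 - x), wone = r - 1\<rparr>"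

lemma luk_chain_in_wajsberg_chains: "0 < r \<Longrightarrow> luk_chain r \<in> wajsberg_chains r"
proof -
  assume "0 < r"
  then have "wajsberg_algebra (luk_chain r)"
    by unfold_locales (simp_all add: luk_chain_def, linarith+)
  with \<open>0 < r\<close> show ?thesis
    by (auto simp: wajsberg_chains_def wajsberg_algebras_def wtotal_def wle_def luk_chain_def)
qed

end

theory Submission
  imports Defs
begin

text \<open>
  A finite Wajsberg algebra is determined up to isomorphism by a multiset of numbers, and the
  multisets that occur are the factorizations of its order into factors greater than \<open>1\<close>.

  Call the \<^emph>\<open>block\<close> of a coatom \<open>m\<close> the set of elements that have no coatom other than \<open>m\<close> above
  them. Prelinearity, \<open>(x \<triangleright> y) \<squnion> (y \<triangleright> x) = 1\<close>, makes each block a chain (\<open>block_chain\<close>). As the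
  algebra is finite, the block has a least element \<open>base m\<close> and is the interval \<open>[base m, 1]\<close>.
  Minimality forces \<open>base m\<close> to be complemented (\<open>base_boolean\<close>), and joining with a complemented
  element \<open>c\<close> is a homomorphism onto \<open>[c, 1]\<close> (\<open>join_boolean_imp\<close>). These homomorphisms, taken over
  all coatoms, separate elements because every element other than \<open>1\<close> is below a coatom, and their
  values can be prescribed independently because elements of the block of \<open>m\<close> have join \<open>1\<close> with
  \<open>base k\<close> for \<open>k \<noteq> m\<close>. So the algebra is the direct product of its blocks
  (\<open>wiso_product_of_blocks\<close>).

  A finite chain is determined by its order: since \<open>z \<mapsto> z \<triangleright> y\<close> is an order-reversing involution of
  \<open>[y, 1]\<close>, the value \<open>x \<triangleright> y\<close> is found by counting elements (\<open>chain_wiso_luk_chain\<close>). Hence two finite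
  algebras with the same multiset of block sizes are isomorphic. Conversely this multiset depends
  on the order only and is an isomorphism invariant, and a product of nontrivial chains has
  its factors' orders as block sizes (\<open>block_sizes_direct_product\<close>). Isomorphism types of order \<open>n\<close> therefore
  correspond to factorizations of \<open>n\<close>. Chains are the algebras with at most one block, and the
  factorizations with at least two factors are the decompositions that \<open>num_decompositions\<close> counts.

  For the total number, a product of order \<open>n\<close> has \<open>(n - 2)!\<close> relabellings, one for each permutation
  of the elements other than \<open>0\<close> and \<open>1\<close>. The transported algebras are isomorphic to the product,
  hence are not chains, and all of them are counted.
\<close>

section \<open>Order and implication in Wajsberg algebras\<close>

context wajsberg_algebra
begin

abbreviation one ("\<one>") where "\<one> \<equiv> wone W"
abbreviation zero ("\<zero>") where "\<zero> \<equiv> wneg W (wone W)"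
abbreviation below (infix "\<preceq>" 50) where "x \<preceq> y \<equiv> x \<triangleright> y = \<one>"
abbreviation join (infixl "\<squnion>" 65) where "x \<squnion> y \<equiv> (x \<triangleright> y) \<triangleright> y"

lemma zero_closed: "\<zero> \<in> carrier W"
  by (intro neg_closed one_closed)

lemmas closed = imp_closed neg_closed one_closed zero_closed

lemma below_refl: "x \<in> carrier W \<Longrightarrow> x \<preceq> x"
  using imp_trans[of \<one> \<one> x] by (simp add: closed one_imp)

lemma below_antisym: "\<lbrakk>x \<preceq> y; y \<preceq> x; x \<in> carrier W; y \<in> carrier W\<rbrakk> \<Longrightarrow> x = y"
  using imp_comm[of x y] by (simp add: one_imp)

lemma below_trans:
  "\<lbrakk>x \<preceq> y; y \<preceq> z; x \<in> carrier W; y \<in> carrier W; z \<in> carrier W\<rbrakk> \<Longrightarrow> x \<preceq> z"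
  using imp_trans[of x y z] by (simp add: closed one_imp)

lemma below_imp_imp: "\<lbrakk>x \<in> carrier W; y \<in> carrier W\<rbrakk> \<Longrightarrow> x \<preceq> (x \<triangleright> y) \<triangleright> y"
  using imp_trans[of \<one> x y] by (simp add: closed one_imp)

lemma below_one: "x \<in> carrier W \<Longrightarrow> x \<preceq> \<one>"
  using below_imp_imp[of x \<one>] imp_comm[of x \<one>] by (simp add: closed one_imp below_refl)

lemma below_imp: "\<lbrakk>x \<in> carrier W; z \<in> carrier W\<rbrakk> \<Longrightarrow> z \<preceq> x \<triangleright> z"
  using imp_trans[of x \<one> z] by (simp add: closed one_imp below_one)

lemma imp_antimono:
  "\<lbrakk>x \<preceq> y; x \<in> carrier W; y \<in> carrier W; z \<in> carrier W\<rbrakk> \<Longrightarrow> y \<triangleright> z \<preceq> x \<triangleright> z"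
  using imp_trans[of x y z] by (simp add: closed one_imp)

text \<open>
  Implication is antitone in its first argument, and \<open>y\<close> lies below \<open>(y \<triangleright> z) \<triangleright> z\<close>.
\<close>
lemma imp_exchange_below:
  assumes "x \<in> carrier W" "y \<in> carrier W" "z \<in> carrier W"
  shows "x \<triangleright> (y \<triangleright> z) \<preceq> y \<triangleright> (x \<triangleright> z)"
proof (rule below_trans)
  show "x \<triangleright> (y \<triangleright> z) \<preceq> ((y \<triangleright> z) \<triangleright> z) \<triangleright> (x \<triangleright> z)"
    using assms by (intro imp_trans closed)
  show "((y \<triangleright> z) \<triangleright> z) \<triangleright> (x \<triangleright> z) \<preceq> y \<triangleright> (x \<triangleright> z)"
    using assms by (intro imp_antimono below_imp_imp closed)
qed (use assms in \<open>auto intro!: closed\<close>)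

lemma imp_exchange:
  assumes "x \<in> carrier W" "y \<in> carrier W" "z \<in> carrier W"
  shows "x \<triangleright> (y \<triangleright> z) = y \<triangleright> (x \<triangleright> z)"
  using assms by (auto intro: below_antisym[OF imp_exchange_below imp_exchange_below] simp: closed)

lemma imp_mono:
  assumes "y \<preceq> z" "x \<in> carrier W" "y \<in> carrier W" "z \<in> carrier W"
  shows "x \<triangleright> y \<preceq> x \<triangleright> z"
proof -
  have "(x \<triangleright> y) \<triangleright> ((y \<triangleright> z) \<triangleright> (x \<triangleright> z)) = \<one>"
    using assms by (intro imp_trans)
  then show ?thesis using assms by (simp add: closed one_imp)
qed

lemma zero_below: assumes "x \<in> carrier W" shows "\<zero> \<preceq> x"
proof (rule below_trans)
  show "\<zero> \<preceq> wneg W x \<triangleright> \<zero>" using assms by (intro below_imp closed)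
  show "wneg W x \<triangleright> \<zero> \<preceq> x"
    using neg_contr[of x \<one>] assms by (simp add: closed one_imp)
qed (use assms in \<open>auto intro!: closed\<close>)

text \<open>
  This makes negation a matter of implication and the least element alone. An interval
  \<open>[c, 1]\<close> therefore becomes an algebra once \<open>c\<close> takes the place of \<open>\<zero>\<close>, and a map that
  respects implication respects negation as soon as it sends least element to least element.
\<close>
lemma neg_eq_imp_zero: assumes x: "x \<in> carrier W" shows "wneg W x = x \<triangleright> \<zero>"
proof (rule below_antisym)
  have "wneg W \<zero> \<triangleright> wneg W x \<preceq> x \<triangleright> \<zero>"
    using x by (intro neg_contr closed)
  moreover have "wneg W x \<preceq> wneg W \<zero> \<triangleright> wneg W x"
    using x by (intro below_imp closed)
  ultimately show "wneg W x \<preceq> x \<triangleright> \<zero>"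
    using x by (intro below_trans[of "wneg W x" "wneg W \<zero> \<triangleright> wneg W x" "x \<triangleright> \<zero>"]; simp add: closed)
  have "wneg W x \<triangleright> \<zero> \<preceq> x"
    using neg_contr[of x \<one>] x by (simp add: closed one_imp)
  then have "x \<triangleright> \<zero> \<preceq> (wneg W x \<triangleright> \<zero>) \<triangleright> \<zero>"
    using x by (intro imp_antimono closed)
  also have "(wneg W x \<triangleright> \<zero>) \<triangleright> \<zero> = wneg W x"
    using x imp_comm[of "wneg W x" \<zero>] by (simp add: closed one_imp zero_below)
  finally show "x \<triangleright> \<zero> \<preceq> wneg W x" .
qed (use x in \<open>auto intro!: closed\<close>)

lemma join_absorb: "\<lbrakk>y \<preceq> x; x \<in> carrier W; y \<in> carrier W\<rbrakk> \<Longrightarrow> x \<squnion> y = x"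
  using imp_comm[of x y] by (simp add: one_imp)

lemma double_neg: "x \<in> carrier W \<Longrightarrow> (x \<triangleright> \<zero>) \<triangleright> \<zero> = x"
  by (rule join_absorb) (simp_all add: zero_below closed)

lemma join_least:
  assumes "x \<preceq> z" "y \<preceq> z" "x \<in> carrier W" "y \<in> carrier W" "z \<in> carrier W"
  shows "x \<squnion> y \<preceq> z"
proof -
  have "x \<squnion> y \<preceq> z \<squnion> y"
    using assms by (intro imp_antimono closed)
  then show ?thesis using join_absorb[of y z] assms by simp
qed

lemma imp_imp_imp:
  assumes "x \<in> carrier W" "y \<in> carrier W" shows "((x \<triangleright> y) \<triangleright> y) \<triangleright> y = x \<triangleright> y"
  using assms by (auto intro: join_absorb simp: below_imp closed)

lemma contrapositive:
  assumes "x \<in> carrier W" "y \<in> carrier W"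
  shows "(x \<triangleright> \<zero>) \<triangleright> (y \<triangleright> \<zero>) = y \<triangleright> x"
  using imp_exchange[of "x \<triangleright> \<zero>" y \<zero>] double_neg[of x] assms by (simp add: closed)

text \<open>
  The conclusion of the second implication is the meet of \<open>x\<close> and \<open>y\<close>, obtained from the join
  by De Morgan; contraposition turns the claim into absorption for the join.
\<close>
lemma imp_eq_imp_meet:
  assumes x: "x \<in> carrier W" and y: "y \<in> carrier W"
  shows "x \<triangleright> y = x \<triangleright> (((x \<triangleright> \<zero>) \<squnion> (y \<triangleright> \<zero>)) \<triangleright> \<zero>)"
proof -
  let ?a = "x \<triangleright> \<zero>" and ?b = "y \<triangleright> \<zero>"
  have ab: "?a \<in> carrier W" "?b \<in> carrier W" using x y by (simp_all add: closed)
  have "x \<triangleright> ((?a \<squnion> ?b) \<triangleright> \<zero>) = (?a \<squnion> ?b) \<triangleright> ?a"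
    using ab x by (intro imp_exchange; simp add: closed)
  also have "\<dots> = (?b \<squnion> ?a) \<triangleright> ?a"
    by (simp only: imp_comm[OF ab])
  also have "\<dots> = ?b \<triangleright> ?a" using ab by (intro imp_imp_imp)
  also have "\<dots> = x \<triangleright> y" by (rule contrapositive[OF y x])
  finally show ?thesis by simp
qed

text \<open>
  Let \<open>m\<close> be the meet of \<open>x\<close> and \<open>y\<close>. Both implications may be taken into \<open>m\<close>, and exchange gives
  \<open>(x \<triangleright> m) \<triangleright> (y \<triangleright> m) = y \<triangleright> (x \<squnion> m) = y \<triangleright> x\<close>, so the join is \<open>(y \<triangleright> x) \<triangleright> (y \<triangleright> x)\<close>.
\<close>
lemma prelinear:
  assumes x: "x \<in> carrier W" and y: "y \<in> carrier W"
  shows "(x \<triangleright> y) \<squnion> (y \<triangleright> x) = \<one>"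
proof -
  let ?m = "((x \<triangleright> \<zero>) \<squnion> (y \<triangleright> \<zero>)) \<triangleright> \<zero>"
  have m: "?m \<in> carrier W" using x y by (simp add: closed)
  have "x \<triangleright> \<zero> \<preceq> (x \<triangleright> \<zero>) \<squnion> (y \<triangleright> \<zero>)"
    using x y by (intro below_imp_imp closed)
  then have "?m \<preceq> (x \<triangleright> \<zero>) \<triangleright> \<zero>"
    using x y by (intro imp_antimono closed)
  then have mx: "?m \<preceq> x" using x by (simp add: double_neg)
  have xy: "x \<triangleright> y = x \<triangleright> ?m" by (rule imp_eq_imp_meet[OF x y])
  have yx: "y \<triangleright> x = y \<triangleright> ?m"
    unfolding imp_comm[OF imp_closed[OF x zero_closed] imp_closed[OF y zero_closed]]
    by (rule imp_eq_imp_meet[OF y x])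
  have "(x \<triangleright> ?m) \<triangleright> (y \<triangleright> ?m) = y \<triangleright> ((x \<triangleright> ?m) \<triangleright> ?m)"
    using x y m by (intro imp_exchange closed)
  also have "(x \<triangleright> ?m) \<triangleright> ?m = x" using x m mx by (intro join_absorb)
  finally have "(x \<triangleright> y) \<triangleright> (y \<triangleright> x) = y \<triangleright> x" using xy yx by simp
  then show ?thesis using x y by (simp add: below_refl closed)
qed

end


section \<open>Coatoms, blocks and complemented elements\<close>

definition coatoms :: "'a wajsberg \<Rightarrow> 'a set" where
  "coatoms W = {m \<in> carrier W. m \<noteq> wone W \<and> (\<forall>y\<in>carrier W. wle W m y \<longrightarrow> y = m \<or> y = wone W)}"

text \<open>
  In a product of chains a coatom differs from \<open>1\<close> in one coordinate only, and its block is that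
  coordinate: the elements equal to \<open>1\<close> everywhere else. Blocks are thus the factors of the
  product, described by the order alone.
\<close>
definition block :: "'a wajsberg \<Rightarrow> 'a \<Rightarrow> 'a set" where
  "block W m = {x \<in> carrier W. \<forall>k\<in>coatoms W. wle W x k \<longrightarrow> k = m}"

definition block_sizes :: "'a wajsberg \<Rightarrow> nat multiset" where
  "block_sizes W = image_mset (\<lambda>m. card (block W m)) (mset_set (coatoms W))"

text \<open>
  The interval \<open>[c, 1]\<close>. Unlike an interval \<open>[0, e]\<close> it is closed under implication, so only
  the negation has to change.
\<close>
definition upper :: "'a wajsberg \<Rightarrow> 'a \<Rightarrow> 'a wajsberg" where
  "upper W c = \<lparr>carrier = {x \<in> carrier W. wle W c x}, wimp = wimp W,
     wneg = (\<lambda>x. x \<triangleright>\<^bsub>W\<^esub> c), wone = wone W\<rparr>"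

context wajsberg_algebra
begin

lemma upper_algebra:
  assumes c: "c \<in> carrier W"
  shows "wajsberg_algebra (upper W c)"
proof (unfold_locales, goal_cases)
  case (1 x y)
  then have "y \<preceq> x \<triangleright> y" by (auto simp: upper_def wle_def intro: below_imp)
  with 1 c show ?case
    by (auto simp: upper_def wle_def closed intro: below_trans[of c y])
next
  case (2 x)
  with c show ?case by (auto simp: upper_def wle_def closed below_imp)
next
  case 3
  from c show ?case by (auto simp: upper_def wle_def closed below_one)
next
  case (4 x) then show ?case by (simp add: upper_def one_imp)
next
  case (5 x y z) then show ?case by (simp add: upper_def imp_trans)
next
  case (6 x y) then show ?case by (simp add: upper_def imp_comm[of x y])
next
  case (7 x y)
  then have xy: "x \<in> carrier W" "y \<in> carrier W" "c \<preceq> x" by (auto simp: upper_def wle_def)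
  have "(x \<triangleright> c) \<triangleright> (y \<triangleright> c) = y \<triangleright> ((x \<triangleright> c) \<triangleright> c)"
    using xy c by (simp add: imp_exchange closed)
  also have "(x \<triangleright> c) \<triangleright> c = x" using xy c by (intro join_absorb)
  finally show ?case using xy by (simp add: upper_def below_refl closed)
qed

lemma join_upper1: "\<lbrakk>x \<in> carrier W; y \<in> carrier W\<rbrakk> \<Longrightarrow> x \<preceq> x \<squnion> y"
  by (rule below_imp_imp)

lemma join_upper2: "\<lbrakk>x \<in> carrier W; y \<in> carrier W\<rbrakk> \<Longrightarrow> y \<preceq> x \<squnion> y"
  by (simp add: below_imp closed)

text \<open>
  If \<open>c\<close> is complemented by \<open>d = c \<triangleright> \<zero>\<close>, then \<open>d \<squnion> z = \<one>\<close> for \<open>z\<close> above \<open>c\<close>, which says that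
  \<open>d \<triangleright> z\<close> lies below \<open>z\<close>.
\<close>
lemma compl_imp:
  assumes c: "c \<in> carrier W" and bool: "c \<squnion> (c \<triangleright> \<zero>) = \<one>"
    and z: "z \<in> carrier W" "c \<preceq> z"
  shows "(c \<triangleright> \<zero>) \<triangleright> z = z"
proof (rule below_antisym)
  let ?d = "c \<triangleright> \<zero>"
  have d: "?d \<in> carrier W" and j: "?d \<squnion> z \<in> carrier W" using c z by (simp_all add: closed)
  have "c \<squnion> ?d \<preceq> ?d \<squnion> z"
    using c d z j join_upper1[OF d z(1)] below_trans[OF z(2) join_upper2[OF d z(1)]]
    by (intro join_least) simp_all
  then show "?d \<triangleright> z \<preceq> z" using bool j by (simp add: one_imp)
qed (use c z in \<open>simp_all add: below_imp closed\<close>)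

lemma compl_imp_eq_join:
  assumes c: "c \<in> carrier W" and bool: "c \<squnion> (c \<triangleright> \<zero>) = \<one>" and x: "x \<in> carrier W"
  shows "(c \<triangleright> \<zero>) \<triangleright> x = x \<squnion> c"
proof (rule below_antisym)
  let ?d = "c \<triangleright> \<zero>"
  have d: "?d \<in> carrier W" and j: "x \<squnion> c \<in> carrier W" using c x by (simp_all add: closed)
  have "?d \<triangleright> x \<preceq> ?d \<triangleright> (x \<squnion> c)"
    by (rule imp_mono[OF join_upper1[OF x c] d x j])
  also have "?d \<triangleright> (x \<squnion> c) = x \<squnion> c"
    by (rule compl_imp[OF c bool j join_upper2[OF x c]])
  finally show "?d \<triangleright> x \<preceq> x \<squnion> c" .
  have "?d \<triangleright> \<zero> \<preceq> ?d \<triangleright> x"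
    by (rule imp_mono[OF zero_below[OF x] d zero_closed x])
  then have "c \<preceq> ?d \<triangleright> x" using double_neg[OF c] by simp
  then show "x \<squnion> c \<preceq> ?d \<triangleright> x"
    using c d x below_imp[OF d x] by (intro join_least) (simp_all add: closed)
qed (use c x in \<open>simp_all add: closed\<close>)

text \<open>
  Joining with a complemented element \<open>c\<close> is the same as \<open>d \<triangleright> _\<close> for its complement \<open>d\<close>. This map
  respects implication because \<open>d \<triangleright> (d \<triangleright> y) = d \<triangleright> y\<close>: one premise \<open>d\<close> can be used twice.
\<close>
lemma join_boolean_imp:
  assumes c: "c \<in> carrier W" and bool: "c \<squnion> (c \<triangleright> \<zero>) = \<one>"
    and x: "x \<in> carrier W" and y: "y \<in> carrier W"
  shows "(x \<triangleright> y) \<squnion> c = (x \<squnion> c) \<triangleright> (y \<squnion> c)"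
proof -
  let ?d = "c \<triangleright> \<zero>"
  have d: "?d \<in> carrier W" using c by (simp add: closed)
  have dd: "?d \<triangleright> (?d \<triangleright> y) = ?d \<triangleright> y"
    using compl_imp[OF c bool, of "y \<squnion> c"] compl_imp_eq_join[OF c bool y] join_upper2[OF y c] c y
    by (simp add: closed)
  have "?d \<triangleright> (x \<triangleright> y) = (?d \<triangleright> x) \<triangleright> (?d \<triangleright> y)"
  proof (rule below_antisym)
    have "(?d \<triangleright> x) \<triangleright> ((x \<triangleright> y) \<triangleright> (?d \<triangleright> y)) = \<one>"
      by (rule imp_trans[OF d x y])
    then have "x \<triangleright> y \<preceq> (?d \<triangleright> x) \<triangleright> (?d \<triangleright> y)"
      using imp_exchange[of "?d \<triangleright> x" "x \<triangleright> y" "?d \<triangleright> y"] d x y by (simp add: closed)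
    then have "?d \<triangleright> (x \<triangleright> y) \<preceq> ?d \<triangleright> ((?d \<triangleright> x) \<triangleright> (?d \<triangleright> y))"
      using d x y by (intro imp_mono) (simp_all add: closed)
    also have "?d \<triangleright> ((?d \<triangleright> x) \<triangleright> (?d \<triangleright> y)) = (?d \<triangleright> x) \<triangleright> (?d \<triangleright> (?d \<triangleright> y))"
      using d x y by (intro imp_exchange) (simp_all add: closed)
    finally show "?d \<triangleright> (x \<triangleright> y) \<preceq> (?d \<triangleright> x) \<triangleright> (?d \<triangleright> y)" by (simp only: dd)
    have "(?d \<triangleright> x) \<triangleright> (?d \<triangleright> y) \<preceq> x \<triangleright> (?d \<triangleright> y)"
      using imp_antimono[OF below_imp[OF d x] x imp_closed[OF d x] imp_closed[OF d y]] .
    also have "x \<triangleright> (?d \<triangleright> y) = ?d \<triangleright> (x \<triangleright> y)" by (rule imp_exchange[OF x d y])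
    finally show "(?d \<triangleright> x) \<triangleright> (?d \<triangleright> y) \<preceq> ?d \<triangleright> (x \<triangleright> y)" .
  qed (use d x y in \<open>simp_all add: closed\<close>)
  then show ?thesis
    using compl_imp_eq_join[OF c bool] x y by (simp add: closed)
qed

lemma coatom_carrier: "m \<in> coatoms W \<Longrightarrow> m \<in> carrier W"
  by (simp add: coatoms_def)

lemma coatom_above: "\<lbrakk>m \<in> coatoms W; m \<preceq> y; y \<in> carrier W\<rbrakk> \<Longrightarrow> y = m \<or> y = \<one>"
  by (auto simp: coatoms_def wle_def)

lemma coatom_ne_one: "m \<in> coatoms W \<Longrightarrow> m \<noteq> \<one>"
  by (simp add: coatoms_def)

lemma one_below: "\<lbrakk>\<one> \<preceq> x; x \<in> carrier W\<rbrakk> \<Longrightarrow> x = \<one>"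
  by (simp add: one_imp)

lemma blockI:
  "\<lbrakk>x \<in> carrier W; \<And>k. \<lbrakk>k \<in> coatoms W; x \<preceq> k\<rbrakk> \<Longrightarrow> k = m\<rbrakk> \<Longrightarrow> x \<in> block W m"
  by (simp add: block_def wle_def)

lemma block_carrier: "x \<in> block W m \<Longrightarrow> x \<in> carrier W"
  by (simp add: block_def)

lemma blockD: "\<lbrakk>x \<in> block W m; x \<preceq> k; k \<in> coatoms W\<rbrakk> \<Longrightarrow> k = m"
  by (simp add: block_def wle_def)

lemma block_up:
  assumes "x \<in> block W m" "x \<preceq> y" "y \<in> carrier W"
  shows "y \<in> block W m"
proof (rule blockI)
  fix k assume "k \<in> coatoms W" "y \<preceq> k"
  then have "x \<preceq> k"
    using assms coatom_carrier by (auto intro: below_trans[of x y] block_carrier)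
  then show "k = m" using assms \<open>k \<in> coatoms W\<close> by (auto intro: blockD)
qed (use assms in simp)

lemma one_in_block: "\<one> \<in> block W m"
  by (rule blockI) (auto simp: closed dest: one_below coatom_carrier coatom_ne_one)

lemma coatom_in_block:
  assumes "m \<in> coatoms W" shows "m \<in> block W m"
  using assms by (intro blockI) (auto dest: coatom_carrier coatom_above coatom_ne_one)

end

section \<open>The blocks of a finite algebra\<close>

locale finite_wajsberg_algebra = wajsberg_algebra +
  assumes finite_carrier: "finite (carrier W)"
begin

lemma finite_coatoms: "finite (coatoms W)"
  by (rule finite_subset[OF _ finite_carrier]) (auto simp: coatoms_def)

lemma finite_block: "finite (block W m)"
  by (rule finite_subset[OF _ finite_carrier]) (auto simp: block_def)

text \<open>
  If \<open>x\<close> is not a coatom itself, then it lies strictly below some other element than \<open>\<one>\<close>, which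
  has fewer elements above it.
\<close>
lemma ex_coatom_above:
  assumes "x \<in> carrier W" "x \<noteq> \<one>"
  shows "\<exists>m\<in>coatoms W. x \<preceq> m"
  using assms
proof (induction "card {y \<in> carrier W. x \<preceq> y}" arbitrary: x rule: less_induct)
  case less
  show ?case
  proof (cases "x \<in> coatoms W")
    case True
    then show ?thesis using below_refl less.prems by blast
  next
    case False
    then obtain y where y: "y \<in> carrier W" "x \<preceq> y" "y \<noteq> x" "y \<noteq> \<one>"
      using less.prems by (auto simp: coatoms_def wle_def)
    have "{z \<in> carrier W. y \<preceq> z} \<subset> {z \<in> carrier W. x \<preceq> z}"
    proof
      show "{z \<in> carrier W. y \<preceq> z} \<subseteq> {z \<in> carrier W. x \<preceq> z}"
        using y less.prems by (auto intro: below_trans[of x y])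
      have "\<not> y \<preceq> x" using y less.prems below_antisym[of x y] by auto
      then show "{z \<in> carrier W. y \<preceq> z} \<noteq> {z \<in> carrier W. x \<preceq> z}"
        using less.prems below_refl[of x] by blast
    qed
    then have "card {z \<in> carrier W. y \<preceq> z} < card {z \<in> carrier W. x \<preceq> z}"
      using finite_carrier by (intro psubset_card_mono) simp_all
    from less.hyps[OF this] y obtain m where "m \<in> coatoms W" "y \<preceq> m" by blast
    then show ?thesis using y less.prems coatom_carrier by (blast intro: below_trans[of x y])
  qed
qed

lemma eq_oneI:
  assumes "x \<in> carrier W" "\<And>m. \<lbrakk>m \<in> coatoms W; x \<preceq> m\<rbrakk> \<Longrightarrow> False"
  shows "x = \<one>"
  using ex_coatom_above assms by blast

lemma block_below_coatom:
  assumes "x \<in> block W m" "x \<noteq> \<one>" shows "x \<preceq> m"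
  using ex_coatom_above[of x] assms blockD block_carrier by blast

text \<open>
  The implications \<open>x \<triangleright> y\<close> and \<open>y \<triangleright> x\<close> lie in the block again. If neither were \<open>\<one>\<close>, both would lie
  below \<open>m\<close>, and so would their join, which is \<open>\<one>\<close> by prelinearity.
\<close>
lemma block_chain:
  assumes m: "m \<in> coatoms W" and x: "x \<in> block W m" and y: "y \<in> block W m"
  shows "x \<preceq> y \<or> y \<preceq> x"
proof (rule ccontr)
  assume not: "\<not> ?thesis"
  have c: "x \<in> carrier W" "y \<in> carrier W" "m \<in> carrier W"
    using m x y by (auto intro: block_carrier coatom_carrier)
  have "x \<triangleright> y \<in> block W m" "y \<triangleright> x \<in> block W m"
    using block_up[OF y, of "x \<triangleright> y"] block_up[OF x, of "y \<triangleright> x"] c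
    by (simp_all add: below_imp closed)
  with not have "x \<triangleright> y \<preceq> m" "y \<triangleright> x \<preceq> m" by (auto intro: block_below_coatom)
  then have "(x \<triangleright> y) \<squnion> (y \<triangleright> x) \<preceq> m"
    using c by (intro join_least) (simp_all add: closed)
  then have "\<one> \<preceq> m" using c by (simp only: prelinear)
  then show False using c m one_below coatom_ne_one by blast
qed

lemma ex_block_least:
  assumes m: "m \<in> coatoms W"
  shows "\<exists>c\<in>block W m. \<forall>x\<in>block W m. c \<preceq> x"
proof -
  let ?up = "\<lambda>x. {y \<in> block W m. x \<preceq> y}"
  have "Max ((\<lambda>x. card (?up x)) ` block W m) \<in> (\<lambda>x. card (?up x)) ` block W m"
    using finite_block one_in_block by (intro Max_in) auto
  then obtain c where c: "c \<in> block W m" "card (?up c) = Max ((\<lambda>x. card (?up x)) ` block W m)"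
    by auto
  have "c \<preceq> x" if x: "x \<in> block W m" for x
  proof (rule ccontr)
    assume "\<not> c \<preceq> x"
    then have "x \<preceq> c" using block_chain[OF m c(1) x] by blast
    then have "?up c \<subseteq> ?up x"
      using c x by (auto intro: below_trans[of x c] block_carrier)
    moreover have "x \<in> ?up x" using x by (auto intro: below_refl block_carrier)
    ultimately have "?up c \<subset> ?up x" using \<open>\<not> c \<preceq> x\<close> by blast
    then have "card (?up c) < card (?up x)"
      using finite_block by (intro psubset_card_mono) simp_all
    moreover have "card (?up x) \<le> card (?up c)"
      unfolding c(2) using x finite_block by (intro Max_ge) auto
    ultimately show False by simp
  qed
  with c show ?thesis by blast
qed

definition base :: "'a \<Rightarrow> 'a" where
  "base m = (SOME c. c \<in> block W m \<and> (\<forall>x\<in>block W m. c \<preceq> x))"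

lemma base_in_block: "m \<in> coatoms W \<Longrightarrow> base m \<in> block W m"
  and base_below: "\<lbrakk>m \<in> coatoms W; x \<in> block W m\<rbrakk> \<Longrightarrow> base m \<preceq> x"
proof -
  have "base m \<in> block W m \<and> (\<forall>x\<in>block W m. base m \<preceq> x)" if "m \<in> coatoms W" for m
    unfolding base_def using ex_block_least[OF that]
    by (intro someI_ex[of "\<lambda>c. c \<in> block W m \<and> (\<forall>x\<in>block W m. c \<preceq> x)"]) blast
  then show "m \<in> coatoms W \<Longrightarrow> base m \<in> block W m"
    "\<lbrakk>m \<in> coatoms W; x \<in> block W m\<rbrakk> \<Longrightarrow> base m \<preceq> x" by blast+
qed

lemma base_carrier: "m \<in> coatoms W \<Longrightarrow> base m \<in> carrier W"
  by (rule block_carrier[OF base_in_block])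

lemma block_eq: "m \<in> coatoms W \<Longrightarrow> block W m = {x \<in> carrier W. base m \<preceq> x}"
  by (auto intro: base_below block_carrier block_up[OF base_in_block])

text \<open>
  A coatom \<open>k\<close> that is not above \<open>x\<close> has join \<open>\<one>\<close> with \<open>x\<close>, which says that \<open>x \<triangleright> k\<close> lies
  below \<open>k\<close>.
\<close>
lemma imp_coatom:
  assumes k: "k \<in> coatoms W" and x: "x \<in> carrier W" "\<not> x \<preceq> k"
  shows "x \<triangleright> k = k"
proof -
  have kc: "k \<in> carrier W" using k by (rule coatom_carrier)
  have "x \<squnion> k = k \<or> x \<squnion> k = \<one>"
    using k kc x by (intro coatom_above) (simp_all add: closed join_upper2)
  moreover have "x \<squnion> k \<noteq> k" using join_upper1[OF x(1) kc] x by auto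
  ultimately show ?thesis
    using below_antisym[of "x \<triangleright> k" k] below_imp[OF x(1) kc] x kc by (auto simp: closed)
qed

text \<open>
  For the base \<open>c\<close>, the element \<open>s\<close> below is the strong conjunction of \<open>c\<close> with itself. A coatom
  \<open>k \<noteq> m\<close> is not above \<open>c\<close>, hence \<open>c \<triangleright> (c \<triangleright> k) = k\<close> and \<open>k\<close> is not above \<open>s\<close> either. So \<open>s\<close> is in
  the block and \<open>c\<close>, as its least element, lies below \<open>s\<close>; by exchange this is the claim.
\<close>
lemma base_boolean:
  assumes m: "m \<in> coatoms W"
  shows "base m \<squnion> (base m \<triangleright> \<zero>) = \<one>"
proof -
  let ?c = "base m"
  let ?s = "(?c \<triangleright> (?c \<triangleright> \<zero>)) \<triangleright> \<zero>"
  have c: "?c \<in> carrier W" using m by (rule base_carrier)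
  have s: "?s \<in> carrier W" using c by (simp add: closed)
  have "?s \<in> block W m"
  proof (rule blockI[OF s], rule ccontr)
    fix k assume k: "k \<in> coatoms W" "?s \<preceq> k" "k \<noteq> m"
    have kc: "k \<in> carrier W" using k by (intro coatom_carrier)
    have ck: "?c \<triangleright> k = k"
      using k c blockD[OF base_in_block[OF m]] by (intro imp_coatom) auto
    have "?s \<triangleright> k = ?s \<triangleright> ((k \<triangleright> \<zero>) \<triangleright> \<zero>)" using kc by (simp only: double_neg)
    also have "\<dots> = (k \<triangleright> \<zero>) \<triangleright> (?c \<triangleright> (?c \<triangleright> \<zero>))"
      using c kc by (intro contrapositive) (simp_all add: closed)
    also have "\<dots> = ?c \<triangleright> ((k \<triangleright> \<zero>) \<triangleright> (?c \<triangleright> \<zero>))"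
      using c kc by (intro imp_exchange) (simp_all add: closed)
    also have "\<dots> = ?c \<triangleright> (?c \<triangleright> k)" using c kc by (simp only: contrapositive)
    also have "\<dots> = k" by (simp only: ck)
    finally show False using k(2) coatom_ne_one[OF k(1)] by simp
  qed
  then have "?c \<preceq> ?s" by (rule base_below[OF m])
  then show ?thesis
    using imp_exchange[of ?c "?c \<triangleright> (?c \<triangleright> \<zero>)" \<zero>] c by (simp add: closed)
qed

lemmas join_base_imp = join_boolean_imp[OF base_carrier base_boolean]

lemma join_base_in_block: "\<lbrakk>m \<in> coatoms W; x \<in> carrier W\<rbrakk> \<Longrightarrow> x \<squnion> base m \<in> block W m"
  by (auto simp: block_eq closed base_carrier join_upper2)

lemma join_base_absorb: "\<lbrakk>m \<in> coatoms W; x \<in> block W m\<rbrakk> \<Longrightarrow> x \<squnion> base m = x"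
  by (intro join_absorb base_below) (auto intro: base_carrier block_carrier)

text \<open>
  The join lies in the blocks of both \<open>m\<close> and \<open>k\<close>, so a coatom above it would equal both.
\<close>
lemma join_other_base:
  assumes m: "m \<in> coatoms W" and k: "k \<in> coatoms W" and "k \<noteq> m" and x: "x \<in> block W m"
  shows "x \<squnion> base k = \<one>"
proof (rule eq_oneI)
  have c: "x \<in> carrier W" "base k \<in> carrier W" using x k by (auto intro: block_carrier base_carrier)
  then show "x \<squnion> base k \<in> carrier W" by (simp add: closed)
  fix l assume l: "l \<in> coatoms W" "x \<squnion> base k \<preceq> l"
  have "x \<squnion> base k \<in> block W m" "x \<squnion> base k \<in> block W k"
    using c by (auto simp: closed intro: block_up[OF x] join_upper1 join_base_in_block[OF k])
  then show False using l blockD \<open>k \<noteq> m\<close> by metis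
qed

text \<open>
  The injectivity of the map into the product of the blocks: a coatom \<open>m\<close> above \<open>x \<triangleright> y\<close> would be
  above \<open>(x \<triangleright> y) \<squnion> base m\<close>, which is \<open>\<one>\<close> because joining with \<open>base m\<close> respects implication
  and identifies \<open>x\<close> with \<open>y\<close>.
\<close>
lemma below_if_join_base:
  assumes x: "x \<in> carrier W" and y: "y \<in> carrier W"
    and eq: "\<And>m. m \<in> coatoms W \<Longrightarrow> x \<squnion> base m = y \<squnion> base m"
  shows "x \<preceq> y"
proof (rule eq_oneI)
  fix m assume m: "m \<in> coatoms W" "x \<triangleright> y \<preceq> m"
  have c: "m \<in> carrier W" "base m \<in> carrier W" using m by (auto intro: coatom_carrier base_carrier)
  have "(x \<triangleright> y) \<squnion> base m \<preceq> m"
    using c m x y base_below[OF m(1) coatom_in_block[OF m(1)]] by (intro join_least) (simp_all add: closed)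
  moreover have "(x \<triangleright> y) \<squnion> base m = \<one>"
    using join_base_imp[OF m(1) m(1) x y] eq[OF m(1)] y c by (simp add: closed below_refl)
  ultimately show False using c m one_below coatom_ne_one by metis
qed (use x y in \<open>simp add: closed\<close>)

text \<open>
  The surjectivity of the map into the product of the blocks. The coordinates are set one at a
  time by the strong conjunction \<open>(u \<triangleright> (v \<triangleright> \<zero>)) \<triangleright> \<zero>\<close>, where \<open>v\<close> is the prescribed element of the
  next block: in each coordinate one of \<open>u\<close> and \<open>v\<close> becomes \<open>\<one>\<close> and the other one survives.
\<close>
lemma ex_join_base:
  assumes "finite K" "K \<subseteq> coatoms W" and g: "\<And>m. m \<in> K \<Longrightarrow> g m \<in> block W m"
  shows "\<exists>x\<in>carrier W. \<forall>m\<in>coatoms W. x \<squnion> base m = (if m \<in> K then g m else \<one>)"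
  using assms
proof (induction K rule: finite_induct)
  case empty
  have "\<one> \<squnion> base m = \<one>" if "m \<in> coatoms W" for m
    using that by (simp add: one_imp below_refl base_carrier)
  then show ?case using one_closed by auto
next
  case (insert k K)
  then obtain u where u: "u \<in> carrier W"
    "\<And>m. m \<in> coatoms W \<Longrightarrow> u \<squnion> base m = (if m \<in> K then g m else \<one>)"
    by auto
  have k: "k \<in> coatoms W" and gk: "g k \<in> block W k" using insert.prems by auto
  have v: "g k \<in> carrier W" using gk by (rule block_carrier)
  define p where "p = (u \<triangleright> (g k \<triangleright> \<zero>)) \<triangleright> \<zero>"
  have p: "p \<in> carrier W" using u v by (simp add: p_def closed)
  have "p \<squnion> base m = (if m \<in> insert k K then g m else \<one>)" if m: "m \<in> coatoms W" for m
  proof -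
    let ?c = "base m"
    have c: "?c \<in> carrier W" using m by (rule base_carrier)
    have z: "\<zero> \<squnion> ?c = ?c" using c by (simp add: zero_below one_imp)
    \<comment> \<open>Joining with \<open>?c\<close> respects implication and turns \<open>\<zero>\<close> into \<open>?c\<close>.\<close>
    have "p \<squnion> ?c = ((u \<squnion> ?c) \<triangleright> ((g k \<squnion> ?c) \<triangleright> ?c)) \<triangleright> ?c"
      unfolding p_def using u v
      by (simp only: join_base_imp[OF m m] closed z)
    also have "\<dots> = (if m \<in> insert k K then g m else \<one>)"
    proof (cases "m = k")
      case True
      then have "u \<squnion> ?c = \<one>" using u(2)[OF m] insert.hyps by simp
      moreover have "g k \<squnion> ?c = g k" using True gk m by (auto intro: join_base_absorb)
      ultimately show ?thesis using True v c by (simp add: one_imp closed)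
    next
      case False
      then have "g k \<squnion> ?c = \<one>" by (intro join_other_base[OF k m _ gk]) auto
      moreover have "u \<squnion> ?c \<squnion> ?c = u \<squnion> ?c"
        using u c by (simp only: imp_imp_imp closed)
      ultimately show ?thesis using False u(2)[OF m] c by (simp add: one_imp)
    qed
    finally show ?thesis .
  qed
  with p show ?case by blast
qed

end


section \<open>Isomorphisms and finite chains\<close>

lemma wisoI:
  assumes "bij_betw h (carrier V) (carrier W)"
    and "\<And>x y. \<lbrakk>x \<in> carrier V; y \<in> carrier V\<rbrakk> \<Longrightarrow> h (x \<triangleright>\<^bsub>V\<^esub> y) = h x \<triangleright>\<^bsub>W\<^esub> h y"
    and "\<And>x. x \<in> carrier V \<Longrightarrow> h (wneg V x) = wneg W (h x)"
    and "h (wone V) = wone W"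
  shows "h \<in> wiso V W"
  using assms by (simp add: wiso_def)

lemma wisoD:
  assumes "h \<in> wiso V W"
  shows "bij_betw h (carrier V) (carrier W)"
    and "\<And>x y. \<lbrakk>x \<in> carrier V; y \<in> carrier V\<rbrakk> \<Longrightarrow> h (x \<triangleright>\<^bsub>V\<^esub> y) = h x \<triangleright>\<^bsub>W\<^esub> h y"
    and "\<And>x. x \<in> carrier V \<Longrightarrow> h (wneg V x) = wneg W (h x)"
    and "h (wone V) = wone W"
    and "\<And>x. x \<in> carrier V \<Longrightarrow> h x \<in> carrier W"
  using assms by (auto simp: wiso_def bij_betw_apply)

lemma wiso_comp:
  assumes "g \<in> wiso U V" "h \<in> wiso V W" shows "h \<circ> g \<in> wiso U W"
  using bij_betw_trans[OF wisoD(1)[OF assms(1)] wisoD(1)[OF assms(2)]]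
  by (intro wisoI) (simp_all add: wisoD[OF assms(1)] wisoD[OF assms(2)])

lemma wiso_inverse:
  assumes V: "wajsberg_algebra V" and h: "h \<in> wiso V W"
  shows "inv_into (carrier V) h \<in> wiso W V"
proof -
  interpret wajsberg_algebra V by (rule V)
  let ?g = "inv_into (carrier V) h"
  have inj: "inj_on h (carrier V)" and im: "h ` carrier V = carrier W"
    using wisoD(1)[OF h] by (auto simp: bij_betw_def)
  have g: "?g y \<in> carrier V" "h (?g y) = y" if "y \<in> carrier W" for y
    using that inv_into_into[of y h] f_inv_into_f[of y h] im by auto
  have gI: "?g y = x" if "x \<in> carrier V" "h x = y" for x y
    using that inj by auto
  show ?thesis
    using g by (intro wisoI bij_betw_inv_into wisoD(1)[OF h] gI) (simp_all add: closed wisoD[OF h])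
qed

lemma wiso_wajsberg_algebra:
  assumes V: "wajsberg_algebra V" and h: "h \<in> wiso V W"
  shows "wajsberg_algebra W"
proof -
  interpret wajsberg_algebra V by (rule V)
  have im: "carrier W = h ` carrier V"
    using wisoD(1)[OF h] by (simp add: bij_betw_def)
  note [simp] = wisoD(2-4)[OF h, symmetric] closed
  show ?thesis
    unfolding wajsberg_algebra_def im
    using imp_comm by (auto simp: one_imp imp_trans neg_contr)
qed

lemma wiso_wle:
  assumes V: "wajsberg_algebra V" and h: "h \<in> wiso V W"
    and x: "x \<in> carrier V" and y: "y \<in> carrier V"
  shows "wle W (h x) (h y) \<longleftrightarrow> wle V x y"
proof -
  interpret wajsberg_algebra V by (rule V)
  have "h (x \<triangleright>\<^bsub>V\<^esub> y) = h (wone V) \<longleftrightarrow> x \<triangleright>\<^bsub>V\<^esub> y = wone V"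
    using wisoD(1)[OF h] x y by (auto simp: bij_betw_def inj_on_def closed)
  then show ?thesis using wisoD(2,4)[OF h] x y by (simp add: wle_def)
qed

text \<open>
  Coatoms and blocks are defined by the order, which isomorphisms preserve.
\<close>
lemma block_sizes_wiso:
  assumes V: "wajsberg_algebra V" and h: "h \<in> wiso V W"
  shows "block_sizes V = block_sizes W"
proof -
  interpret wajsberg_algebra V by (rule V)
  have inj: "inj_on h (carrier V)" and im: "carrier W = h ` carrier V"
    using wisoD(1)[OF h] by (auto simp: bij_betw_def)
  have ball: "(\<forall>y\<in>carrier W. P y) \<longleftrightarrow> (\<forall>x\<in>carrier V. P (h x))" for P
    using im by auto
  have eq: "h x = h y \<longleftrightarrow> x = y" if "x \<in> carrier V" "y \<in> carrier V" for x y
    using that inj by (auto simp: inj_on_def)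
  note le = wiso_wle[OF V h]
  have mem: "h x \<in> coatoms W \<longleftrightarrow> x \<in> coatoms V" if x: "x \<in> carrier V" for x
    using x wisoD(5)[OF h x]
    by (simp add: coatoms_def ball le eq closed wisoD(4)[OF h, symmetric])
  have co: "coatoms W = h ` coatoms V"
    using mem im by (auto simp: image_iff) (auto simp: coatoms_def)
  have blk: "block W (h m) = h ` block V m" if m: "m \<in> coatoms V" for m
  proof -
    have "h x \<in> block W (h m) \<longleftrightarrow> x \<in> block V m" if x: "x \<in> carrier V" for x
      using x m wisoD(5)[OF h x] by (auto simp: block_def co le eq coatom_carrier)
    then show ?thesis using im by (auto simp: image_iff) (auto simp: block_def)
  qed
  have injc: "inj_on h (coatoms V)"
    by (rule inj_on_subset[OF inj]) (auto simp: coatoms_def)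
  have cb: "card (block W (h m)) = card (block V m)" if m: "m \<in> coatoms V" for m
    unfolding blk[OF m]
    by (intro card_image inj_on_subset[OF inj]) (auto simp: block_def)
  have "block_sizes W = image_mset (\<lambda>m. card (block W (h m))) (mset_set (coatoms V))"
    unfolding block_sizes_def co image_mset_mset_set[OF injc, symmetric]
    by (simp add: multiset.map_comp comp_def)
  also have "\<dots> = block_sizes V"
    unfolding block_sizes_def
    by (intro image_mset_cong) (metis cb elem_mset_set mset_set.infinite empty_iff set_mset_empty)
  finally show ?thesis by simp
qed

context finite_wajsberg_algebra
begin

text \<open>
  The isomorphism sends an element to its position. That positions determine \<open>x \<triangleright> y\<close> for \<open>y\<close>
  below \<open>x\<close> is due to the map \<open>z \<mapsto> z \<triangleright> y\<close>: it is an order-reversing involution of \<open>[y, 1]\<close>, so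
  it matches \<open>[y, x]\<close> with \<open>[x \<triangleright> y, 1]\<close> and these intervals have the same number of elements.
\<close>
lemma chain_wiso_luk_chain:
  assumes tot: "wtotal W"
  shows "wiso W (luk_chain (card (carrier W))) \<noteq> {}"
proof -
  let ?n = "card (carrier W)"
  define up where "up x = {y \<in> carrier W. x \<preceq> y}" for x
  define rank where "rank x = ?n - card (up x)" for x
  have fin: "finite (up x)" for x using finite_carrier by (simp add: up_def)
  have total: "x \<preceq> y \<or> y \<preceq> x" if "x \<in> carrier W" "y \<in> carrier W" for x y
    using tot that by (simp add: wtotal_def wle_def)
  have up_n: "card (up x) \<le> ?n" for x
    using finite_carrier by (intro card_mono) (auto simp: up_def)
  have up_pos: "0 < card (up x)" if "x \<in> carrier W" for x
    using that fin by (auto simp: card_gt_0_iff up_def below_refl)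
  have anti: "up y \<subseteq> up x" if "x \<preceq> y" "x \<in> carrier W" "y \<in> carrier W" for x y
    using that by (auto simp: up_def intro: below_trans[of x y])
  have strict: "card (up y) < card (up x)"
    if "x \<preceq> y" "x \<noteq> y" "x \<in> carrier W" "y \<in> carrier W" for x y
  proof (intro psubset_card_mono fin psubsetI anti that notI)
    assume "up y = up x"
    then have "x \<in> up y" using that by (auto simp: up_def below_refl)
    then show False using that below_antisym[of x y] by (auto simp: up_def)
  qed
  have inj: "inj_on rank (carrier W)"
  proof (rule inj_onI, rule ccontr)
    fix x y assume *: "x \<in> carrier W" "y \<in> carrier W" "rank x = rank y" "x \<noteq> y"
    then have "card (up x) = card (up y)"
      using up_n[of x] up_n[of y] by (simp add: rank_def)
    then show False using * total[of x y] strict[of x y] strict[of y x] by auto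
  qed
  \<comment> \<open>An injection of an \<open>n\<close>-element set into \<open>{..<n}\<close> is onto.\<close>
  have "rank ` carrier W = {..<?n}"
  proof (rule card_subset_eq)
    show "rank ` carrier W \<subseteq> {..<?n}"
    proof (clarsimp simp: rank_def)
      fix x assume "x \<in> carrier W"
      then show "?n - card (up x) < ?n" using up_pos[of x] up_n[of x] by simp
    qed
  qed (use inj in \<open>simp_all add: card_image\<close>)
  then have bij: "bij_betw rank (carrier W) {..<?n}"
    using inj by (simp add: bij_betw_def)
  have "up \<one> = {\<one>}" by (auto simp: up_def closed below_refl dest: one_below)
  then have rank_one: "rank \<one> = ?n - 1" by (simp add: rank_def)
  have "up \<zero> = carrier W" by (auto simp: up_def zero_below)
  then have rank_zero: "rank \<zero> = 0" by (simp add: rank_def)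
  have rank_imp: "rank (x \<triangleright> y) = min (?n - 1) (?n - 1 - rank x + rank y)"
    if x: "x \<in> carrier W" and y: "y \<in> carrier W" for x y
  proof (cases "x \<preceq> y")
    case True
    have "card (up y) \<le> card (up x)"
      using True x y by (intro card_mono fin anti)
    then have "rank x \<le> rank y" by (simp add: rank_def)
    then show ?thesis using True rank_one by simp
  next
    case False
    then have yx: "y \<preceq> x" using total x y by blast
    let ?I = "{z \<in> carrier W. y \<preceq> z \<and> z \<preceq> x}"
    have "bij_betw (\<lambda>z. z \<triangleright> y) ?I (up (x \<triangleright> y))"
    proof (rule bij_betw_byWitness[where f' = "\<lambda>z. z \<triangleright> y"])
      have yw: "y \<preceq> w" if "w \<in> up (x \<triangleright> y)" for w
        using that x y by (auto simp: up_def closed below_imp intro: below_trans[of y "x \<triangleright> y"])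
      show "\<forall>z\<in>?I. z \<squnion> y = z" using y by (auto intro: join_absorb)
      show "\<forall>w\<in>up (x \<triangleright> y). w \<squnion> y = w" using y yw by (auto simp: up_def intro: join_absorb)
      show "(\<lambda>z. z \<triangleright> y) ` ?I \<subseteq> up (x \<triangleright> y)"
        using x y by (auto simp: up_def closed intro: imp_antimono)
      have "w \<triangleright> y \<preceq> x" if "w \<in> up (x \<triangleright> y)" for w
        using that x y imp_antimono[of "x \<triangleright> y" w y] join_absorb[OF yx x y]
        by (auto simp: up_def closed)
      then show "(\<lambda>z. z \<triangleright> y) ` up (x \<triangleright> y) \<subseteq> ?I"
        using x y by (auto simp: up_def closed below_imp)
    qed
    then have "card (up (x \<triangleright> y)) = card ?I" by (rule bij_betw_same_card[symmetric])
    also have "?I = insert x (up y - up x)"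
      using x y yx total below_antisym[of x] by (auto simp: up_def below_refl)
    also have "card \<dots> = Suc (card (up y) - card (up x))"
      using fin anti[OF yx y x] x by (subst card_insert_disjoint)
        (auto simp: card_Diff_subset up_def below_refl)
    finally show ?thesis
      using up_n[of x] up_n[of y] up_pos[OF x] card_mono[OF fin anti[OF yx y x]]
      by (simp add: rank_def)
  qed
  have "rank \<in> wiso W (luk_chain ?n)"
    using bij rank_imp rank_one rank_imp[OF _ zero_closed] rank_zero
    by (intro wisoI) (simp_all add: luk_chain_def neg_eq_imp_zero[of "_ :: 'a"])
  then show ?thesis by blast
qed

end

lemma wajsberg_chainsD:
  assumes "W \<in> wajsberg_chains r"
  shows "finite_wajsberg_algebra W" "wtotal W" "card (carrier W) = r"
  using assms by (auto simp: wajsberg_chains_def wajsberg_algebras_def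
    finite_wajsberg_algebra_def finite_wajsberg_algebra_axioms_def)

lemma chains_wiso:
  assumes V: "V \<in> wajsberg_chains r" and W: "W \<in> wajsberg_chains r"
  shows "wiso V W \<noteq> {}"
proof -
  obtain g h where g: "g \<in> wiso V (luk_chain r)" and h: "h \<in> wiso W (luk_chain r)"
    using finite_wajsberg_algebra.chain_wiso_luk_chain[OF wajsberg_chainsD(1,2)[OF V]]
      finite_wajsberg_algebra.chain_wiso_luk_chain[OF wajsberg_chainsD(1,2)[OF W]]
      wajsberg_chainsD(3)[OF V] wajsberg_chainsD(3)[OF W] by auto
  have "wajsberg_algebra W" using wajsberg_chainsD(1)[OF W] by (simp add: finite_wajsberg_algebra_def)
  from wiso_comp[OF g wiso_inverse[OF this h]] show ?thesis by blast
qed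


section \<open>Direct products and the decomposition into chains\<close>

lemma carrier_direct_product:
  "xs \<in> carrier (direct_product Ws) \<longleftrightarrow>
     length xs = length Ws \<and> (\<forall>i<length Ws. xs ! i \<in> carrier (Ws ! i))"
  by (auto simp: direct_product_def list_all2_conv_all_nth)

lemma direct_product_ops:
  "xs \<triangleright>\<^bsub>direct_product Ws\<^esub> ys = map (\<lambda>i. xs ! i \<triangleright>\<^bsub>Ws ! i\<^esub> ys ! i) [0..<length Ws]"
  "wneg (direct_product Ws) xs = map (\<lambda>i. wneg (Ws ! i) (xs ! i)) [0..<length Ws]"
  "wone (direct_product Ws) = map (\<lambda>i. wone (Ws ! i)) [0..<length Ws]"
  by (simp_all add: direct_product_def) (intro nth_equalityI; simp)

lemma wajsberg_algebra_direct_product: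
  assumes "\<And>W. W \<in> set Ws \<Longrightarrow> wajsberg_algebra W"
  shows "wajsberg_algebra (direct_product Ws)"
proof -
  have W: "wajsberg_algebra (Ws ! i)" if "i < length Ws" for i
    by (rule assms[OF nth_mem[OF that]])
  note simps = carrier_direct_product direct_product_ops
  show ?thesis
  proof (rule wajsberg_algebra.intro, goal_cases)
    case 1 then show ?case by (simp add: simps wajsberg_algebra.imp_closed[OF W])
  next
    case 2 then show ?case by (simp add: simps wajsberg_algebra.neg_closed[OF W])
  next
    case 3 then show ?case by (simp add: simps wajsberg_algebra.one_closed[OF W])
  next
    case 4 then show ?case
      by (intro nth_equalityI) (simp_all add: simps wajsberg_algebra.one_imp[OF W])
  next
    case 5 then show ?case
      by (intro nth_equalityI) (simp_all add: simps wajsberg_algebra.imp_trans[OF W])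
  next
    case (6 xs ys)
    have "(xs ! i \<triangleright>\<^bsub>Ws ! i\<^esub> ys ! i) \<triangleright>\<^bsub>Ws ! i\<^esub> ys ! i = (ys ! i \<triangleright>\<^bsub>Ws ! i\<^esub> xs ! i) \<triangleright>\<^bsub>Ws ! i\<^esub> xs ! i"
      if "i < length Ws" for i
      using 6 that by (intro wajsberg_algebra.imp_comm[OF W]) (simp_all add: simps)
    then show ?case by (intro nth_equalityI) (simp_all add: simps)
  next
    case 7 then show ?case
      by (intro nth_equalityI) (simp_all add: simps wajsberg_algebra.neg_contr[OF W])
  qed
qed

lemma wle_direct_product:
  "wle (direct_product Ws) xs ys \<longleftrightarrow> (\<forall>i<length Ws. wle (Ws ! i) (xs ! i) (ys ! i))"
  by (auto simp: wle_def direct_product_ops map_eq_conv)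

lemma carrier_direct_product_Cons:
  "carrier (direct_product (W # Ws)) =
     (\<lambda>(x, xs). x # xs) ` (carrier W \<times> carrier (direct_product Ws))"
  by (auto simp: direct_product_def list_all2_Cons2)

lemma finite_card_direct_product:
  assumes "\<And>W. W \<in> set Ws \<Longrightarrow> finite (carrier W)"
  shows "finite (carrier (direct_product Ws)) \<and>
    card (carrier (direct_product Ws)) = prod_list (map (\<lambda>W. card (carrier W)) Ws)"
  using assms
proof (induction Ws)
  case Nil
  then show ?case by (simp add: direct_product_def)
next
  case (Cons W Ws)
  have "inj_on (\<lambda>(x, xs). x # xs) (carrier W \<times> carrier (direct_product Ws))"
    by (auto simp: inj_on_def)
  then show ?case
    using Cons by (simp add: carrier_direct_product_Cons card_image card_cartesian_product)
qed

lemma direct_product_wiso: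
  assumes len: "length Vs = length Ws"
    and iso: "\<And>i. i < length Ws \<Longrightarrow> wiso (Vs ! i) (Ws ! i) \<noteq> {}"
  shows "wiso (direct_product Vs) (direct_product Ws) \<noteq> {}"
proof -
  have "\<forall>i. \<exists>h. i < length Ws \<longrightarrow> h \<in> wiso (Vs ! i) (Ws ! i)" using iso by blast
  then obtain h where h: "\<And>i. i < length Ws \<Longrightarrow> h i \<in> wiso (Vs ! i) (Ws ! i)"
    unfolding choice_iff by blast
  let ?n = "length Ws"
  let ?H = "\<lambda>xs. map (\<lambda>i. h i (xs ! i)) [0..<?n]"
  let ?G = "\<lambda>xs. map (\<lambda>i. inv_into (carrier (Vs ! i)) (h i) (xs ! i)) [0..<?n]"
  have bij: "bij_betw (h i) (carrier (Vs ! i)) (carrier (Ws ! i))" if "i < ?n" for i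
    by (rule wisoD(1)[OF h[OF that]])
  have "bij_betw ?H (carrier (direct_product Vs)) (carrier (direct_product Ws))"
  proof (rule bij_betw_byWitness[where f' = ?G])
    show "\<forall>xs\<in>carrier (direct_product Vs). ?G (?H xs) = xs"
      by (auto simp: carrier_direct_product len bij_betw_inv_into_left[OF bij] intro!: nth_equalityI)
    show "\<forall>xs\<in>carrier (direct_product Ws). ?H (?G xs) = xs"
      by (auto simp: carrier_direct_product len bij_betw_inv_into_right[OF bij] intro!: nth_equalityI)
    show "?H ` carrier (direct_product Vs) \<subseteq> carrier (direct_product Ws)"
      by (auto simp: carrier_direct_product len bij_betw_apply[OF bij])
    show "?G ` carrier (direct_product Ws) \<subseteq> carrier (direct_product Vs)"
      by (auto simp: carrier_direct_product len bij_betw_apply[OF bij_betw_inv_into[OF bij]])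
  qed
  then have "?H \<in> wiso (direct_product Vs) (direct_product Ws)"
    using len
    by (intro wisoI)
      (auto simp: carrier_direct_product direct_product_ops wisoD[OF h] intro!: nth_equalityI)
  then show ?thesis by blast
qed

context finite_wajsberg_algebra
begin

lemma wiso_product_of_blocks:
  assumes dist: "distinct ms" and ms: "set ms = coatoms W"
  shows "wiso W (direct_product (map (\<lambda>m. upper W (base m)) ms)) \<noteq> {}"
proof -
  let ?P = "direct_product (map (\<lambda>m. upper W (base m)) ms)"
  let ?h = "\<lambda>x. map (\<lambda>m. x \<squnion> base m) ms"
  have m: "ms ! i \<in> coatoms W" if "i < length ms" for i
    using nth_mem[OF that] unfolding ms .
  have carrier_upper: "carrier (upper W (base (ms ! i))) = block W (ms ! i)" if "i < length ms" for i
    using block_eq[OF m[OF that]] by (simp add: upper_def wle_def)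
  have carP: "xs \<in> carrier ?P \<longleftrightarrow> length xs = length ms \<and> (\<forall>i<length ms. xs ! i \<in> block W (ms ! i))" for xs
    by (auto simp: carrier_direct_product carrier_upper)
  have inj: "inj_on ?h (carrier W)"
  proof (rule inj_onI)
    fix x y assume xy: "x \<in> carrier W" "y \<in> carrier W" "?h x = ?h y"
    then have "x \<squnion> base m = y \<squnion> base m" if "m \<in> coatoms W" for m
      using that xy(3) ms by simp
    then have "x \<preceq> y" "y \<preceq> x"
      using xy below_if_join_base[of x y] below_if_join_base[of y x] by auto
    then show "x = y" using xy(1,2) by (rule below_antisym)
  qed
  have im: "?h ` carrier W = carrier ?P"
  proof
    show "?h ` carrier W \<subseteq> carrier ?P"
      using m by (auto simp: carP join_base_in_block)
    show "carrier ?P \<subseteq> ?h ` carrier W"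
    proof
      fix xs assume xs: "xs \<in> carrier ?P"
      define g where "g m = the (map_of (zip ms xs) m)" for m
      have len: "length xs = length ms" using xs by (simp add: carP)
      have g: "g (ms ! i) = xs ! i" if "i < length ms" for i
        using that len dist by (simp add: g_def map_of_zip_nth)
      have "g m \<in> block W m" if "m \<in> coatoms W" for m
        using that xs g unfolding ms[symmetric] in_set_conv_nth carP by auto
      then obtain x where x: "x \<in> carrier W" "\<And>m. m \<in> coatoms W \<Longrightarrow> x \<squnion> base m = g m"
        using ex_join_base[OF finite_coatoms subset_refl, of g] by auto
      have "?h x = xs"
        using len g m by (intro nth_equalityI) (simp_all add: x(2))
      then show "xs \<in> ?h ` carrier W" using x(1) by blast
    qed
  qed
  have zero: "\<zero> \<squnion> base (ms ! i) = base (ms ! i)" if "i < length ms" for i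
    using base_carrier[OF m[OF that]] by (simp add: zero_below one_imp)
  have "?h \<in> wiso W ?P"
  proof (rule wisoI)
    show "bij_betw ?h (carrier W) (carrier ?P)" using inj im by (simp add: bij_betw_def)
  next
    fix x y assume "x \<in> carrier W" "y \<in> carrier W"
    then show "?h (x \<triangleright> y) = ?h x \<triangleright>\<^bsub>?P\<^esub> ?h y"
      by (intro nth_equalityI) (simp_all add: direct_product_ops upper_def join_base_imp[OF m m])
  next
    fix x assume x: "x \<in> carrier W"
    have "wneg W x \<squnion> base (ms ! i) = (x \<squnion> base (ms ! i)) \<triangleright> base (ms ! i)" if "i < length ms" for i
      using join_base_imp[OF m m x zero_closed, OF that that] zero[OF that] neg_eq_imp_zero[OF x] by simp
    then show "?h (wneg W x) = wneg ?P (?h x)"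
      by (intro nth_equalityI) (simp_all add: direct_product_ops upper_def)
  next
    show "?h \<one> = wone ?P"
      using m by (intro nth_equalityI) (simp_all add: direct_product_ops upper_def one_imp below_refl base_carrier)
  qed
  then show ?thesis by blast
qed

lemma upper_base_in_chains:
  assumes m: "m \<in> coatoms W"
  shows "upper W (base m) \<in> wajsberg_chains (card (block W m))"
proof -
  have car: "carrier (upper W (base m)) = block W m"
    using block_eq[OF m] by (simp add: upper_def wle_def)
  have "wtotal (upper W (base m))"
    using block_chain[OF m] by (simp add: wtotal_def car) (simp add: upper_def wle_def)
  then show ?thesis
    using car finite_block upper_algebra[OF base_carrier[OF m]]
    by (simp add: wajsberg_chains_def wajsberg_algebras_def)
qed

text \<open>
  Listing the coatoms by increasing block size produces the factors in the order in which
  \<open>product_of_chains\<close> lists them.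
\<close>
theorem wiso_product_of_chains:
  assumes C: "\<And>r. r \<in># block_sizes W \<Longrightarrow> C r \<in> wajsberg_chains r"
  shows "wiso W (product_of_chains C (block_sizes W)) \<noteq> {}"
proof -
  obtain ks where ks: "set ks = coatoms W" "distinct ks"
    using finite_distinct_list[OF finite_coatoms] by blast
  let ?r = "\<lambda>m. card (block W m)"
  define ms where "ms = sort_key ?r ks"
  have ms: "distinct ms" "set ms = coatoms W" using ks by (simp_all add: ms_def)
  have "mset (map ?r ms) = block_sizes W"
    using ms by (simp add: block_sizes_def mset_set_set flip: ms(2))
  moreover have "sorted (map ?r ms)" by (simp add: ms_def)
  ultimately have sl: "sorted_list_of_multiset (block_sizes W) = map ?r ms"
    by (metis sorted_list_of_multiset_mset sorted_sort_id)
  have size: "?r m \<in># block_sizes W" if "m \<in> coatoms W" for m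
    using that finite_coatoms by (simp add: block_sizes_def)
  have "wiso (direct_product (map (\<lambda>m. upper W (base m)) ms))
      (product_of_chains C (block_sizes W)) \<noteq> {}"
    unfolding product_of_chains_def sl
  proof (rule direct_product_wiso)
    fix i assume "i < length (map C (map ?r ms))"
    then have i: "i < length ms" by simp
    then have m: "ms ! i \<in> coatoms W" using nth_mem[OF i] unfolding ms(2) by blast
    show "wiso (map (\<lambda>m. upper W (base m)) ms ! i) (map C (map ?r ms) ! i) \<noteq> {}"
      using i chains_wiso[OF upper_base_in_chains[OF m] C[OF size[OF m]]] by simp
  qed simp
  then show ?thesis using wiso_product_of_blocks[OF ms] wiso_comp by blast
qed

lemma block_sizes_gt_one:
  assumes "r \<in># block_sizes W" shows "1 < r"
proof -
  obtain m where m: "m \<in> coatoms W" "r = card (block W m)"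
    using assms finite_coatoms by (auto simp: block_sizes_def)
  have "card {m, \<one>} \<le> card (block W m)"
    using coatom_in_block[OF m(1)] one_in_block finite_block by (intro card_mono) auto
  then show ?thesis using coatom_ne_one[OF m(1)] m(2) by simp
qed

text \<open>
  Distinct coatoms are incomparable, and with a single coatom every element is in its block.
\<close>
lemma wtotal_iff_size_block_sizes: "wtotal W \<longleftrightarrow> size (block_sizes W) \<le> 1"
proof
  assume tot: "wtotal W"
  have "k = m" if "k \<in> coatoms W" "m \<in> coatoms W" for k m
    using tot that coatom_above coatom_carrier coatom_ne_one unfolding wtotal_def wle_def by metis
  then show "size (block_sizes W) \<le> 1"
    using finite_coatoms by (simp add: block_sizes_def card_le_Suc0_iff_eq)
next
  assume "size (block_sizes W) \<le> 1"
  then have unique: "k = m" if "k \<in> coatoms W" "m \<in> coatoms W" for k m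
    using that finite_coatoms by (auto simp: block_sizes_def card_le_Suc0_iff_eq)
  show "wtotal W"
  proof (cases "coatoms W = {}")
    case True
    then have "x = \<one>" if "x \<in> carrier W" for x using that ex_coatom_above by auto
    then show ?thesis by (auto simp: wtotal_def wle_def intro: one_imp closed)
  next
    case False
    then obtain m where m: "m \<in> coatoms W" by blast
    then have "carrier W \<subseteq> block W m" using unique by (auto intro: blockI)
    then show ?thesis using block_chain[OF m] by (auto simp: wtotal_def wle_def)
  qed
qed

end


section \<open>The block sizes of a product of chains\<close>

lemma finite_wajsberg_algebraI:
  "W \<in> wajsberg_algebras n \<Longrightarrow> finite_wajsberg_algebra W"
  by (simp add: wajsberg_algebras_def finite_wajsberg_algebra_def finite_wajsberg_algebra_axioms_def)

lemma chain_coatoms: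
  assumes W: "W \<in> wajsberg_chains r" and r: "1 < r"
  shows "\<exists>m. coatoms W = {m}"
proof -
  interpret finite_wajsberg_algebra W by (rule wajsberg_chainsD(1)[OF W])
  obtain x where "x \<in> carrier W" "x \<noteq> wone W"
    using wajsberg_chainsD(3)[OF W] r one_closed
    by (metis card_le_Suc0_iff_eq finite_carrier One_nat_def not_less)
  then obtain m where m: "m \<in> coatoms W" using ex_coatom_above by blast
  have "size (block_sizes W) \<le> 1"
    using wajsberg_chainsD(2)[OF W] wtotal_iff_size_block_sizes by blast
  then have "card (coatoms W) \<le> Suc 0" by (simp add: block_sizes_def)
  then have "\<forall>k\<in>coatoms W. k = m" using m finite_coatoms by (simp add: card_le_Suc0_iff_eq)
  then show ?thesis using m by blast
qed

text \<open>
  The factors can be read off from the product. Let \<open>e i x\<close> have the entry \<open>x\<close> at \<open>i\<close> and \<open>1\<close>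
  elsewhere. With \<open>c i\<close> the only coatom of the \<open>i\<close>-th chain, the coatoms of the product are the
  \<open>e i (c i)\<close>, and the block of \<open>e i (c i)\<close> consists of all \<open>e i x\<close>.
\<close>
lemma block_sizes_direct_product:
  assumes chain: "\<And>W. W \<in> set Ws \<Longrightarrow> \<exists>r>1. W \<in> wajsberg_chains r"
  shows "block_sizes (direct_product Ws) = mset (map (\<lambda>W. card (carrier W)) Ws)"
proof -
  let ?P = "direct_product Ws" and ?n = "length Ws"
  let ?one = "map (\<lambda>i. wone (Ws ! i)) [0..<?n]"
  have fwa: "finite_wajsberg_algebra (Ws ! i)" if "i < ?n" for i
    using chain[OF nth_mem[OF that]] wajsberg_chainsD(1) by blast
  have wa: "wajsberg_algebra (Ws ! i)" if "i < ?n" for i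
    using fwa[OF that] by (simp add: finite_wajsberg_algebra_def)
  have "\<forall>i. \<exists>m. i < ?n \<longrightarrow> coatoms (Ws ! i) = {m}"
    using chain chain_coatoms nth_mem by metis
  then obtain c where c: "\<And>i. i < ?n \<Longrightarrow> coatoms (Ws ! i) = {c i}"
    unfolding choice_iff by blast
  have c_car: "c i \<in> carrier (Ws ! i)" and c_ne: "c i \<noteq> wone (Ws ! i)" if "i < ?n" for i
    using c[OF that] by (auto simp: coatoms_def)
  have c_top: "x = c i \<or> x = wone (Ws ! i)"
    if "i < ?n" "wle (Ws ! i) (c i) x" "x \<in> carrier (Ws ! i)" for i x
    using c[OF that(1)] that(2,3) by (auto simp: coatoms_def)
  have below_c: "wle (Ws ! i) x (c i)"
    if "i < ?n" "x \<in> carrier (Ws ! i)" "x \<noteq> wone (Ws ! i)" for i x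
    using finite_wajsberg_algebra.ex_coatom_above[OF fwa[OF that(1)] that(2,3)] c[OF that(1)]
    by (simp add: wle_def)
  have le_one: "wle (Ws ! i) x (wone (Ws ! i))" if "i < ?n" "x \<in> carrier (Ws ! i)" for i x
    using wajsberg_algebra.below_one[OF wa[OF that(1)] that(2)] by (simp add: wle_def)
  have one_le: "x = wone (Ws ! i)"
    if "i < ?n" "wle (Ws ! i) (wone (Ws ! i)) x" "x \<in> carrier (Ws ! i)" for i x
    using wajsberg_algebra.one_below[OF wa[OF that(1)]] that(2,3) by (simp add: wle_def)
  have refl: "wle (Ws ! i) x x" if "i < ?n" "x \<in> carrier (Ws ! i)" for i x
    using wajsberg_algebra.below_refl[OF wa[OF that(1)] that(2)] by (simp add: wle_def)
  have one_car: "wone (Ws ! i) \<in> carrier (Ws ! i)" if "i < ?n" for i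
    by (rule wajsberg_algebra.one_closed[OF wa[OF that]])

  define e where "e i x = ?one[i := x]" for i x
  have len_e: "length (e i x) = ?n" for i x by (simp add: e_def)
  have e_nth: "e i x ! j = (if j = i then x else wone (Ws ! j))" if "j < ?n" for i j x
    using that by (simp add: e_def nth_list_update)
  have e_car: "e i x \<in> carrier ?P" if "i < ?n" "x \<in> carrier (Ws ! i)" for i x
    using that one_car by (simp add: carrier_direct_product len_e e_nth)
  have below_e: "wle ?P xs (e i (c i))"
    if "i < ?n" "xs \<in> carrier ?P" "xs ! i \<noteq> wone (Ws ! i)" for i xs
    using that below_c le_one by (simp add: wle_direct_product carrier_direct_product e_nth)
  have P_one: "wone ?P = ?one" by (rule direct_product_ops)
  have e_coatom: "e i (c i) \<in> coatoms ?P" if i: "i < ?n" for i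
  proof -
    have "ys = e i (c i) \<or> ys = ?one"
      if ys: "ys \<in> carrier ?P" "wle ?P (e i (c i)) ys" for ys
    proof -
      have len: "length ys = ?n" and car: "\<And>j. j < ?n \<Longrightarrow> ys ! j \<in> carrier (Ws ! j)"
        using ys(1) by (auto simp: carrier_direct_product)
      have le: "wle (Ws ! j) (e i (c i) ! j) (ys ! j)" if "j < ?n" for j
        using ys(2) that by (simp add: wle_direct_product)
      have off: "ys ! j = wone (Ws ! j)" if "j < ?n" "j \<noteq> i" for j
        using le[OF that(1)] that car[OF that(1)] one_le by (simp add: e_nth)
      have "ys ! i = c i \<or> ys ! i = wone (Ws ! i)"
        using le[OF i] car[OF i] c_top i by (simp add: e_nth)
      then show ?thesis
      proof
        assume "ys ! i = c i"
        then have "ys = e i (c i)" using off len by (intro nth_equalityI) (simp_all add: len_e e_nth)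
        then show ?thesis ..
      next
        assume "ys ! i = wone (Ws ! i)"
        then have "ys = ?one" using off len by (intro nth_equalityI; simp) metis
        then show ?thesis ..
      qed
    qed
    moreover have "e i (c i) \<noteq> ?one"
    proof
      assume "e i (c i) = ?one"
      then have "e i (c i) ! i = ?one ! i" by simp
      then show False using i c_ne[OF i] by (simp add: e_nth)
    qed
    ultimately show ?thesis
      using e_car[OF i c_car[OF i]] by (simp add: coatoms_def P_one)
  qed
  have inj: "inj_on (\<lambda>i. e i (c i)) {..<?n}"
  proof (rule inj_onI, rule ccontr)
    fix i j assume *: "i \<in> {..<?n}" "j \<in> {..<?n}" "e i (c i) = e j (c j)" "i \<noteq> j"
    have "e i (c i) ! i = e j (c j) ! i" by (simp only: *(3))
    then show False using *(1,2,4) c_ne[of i] by (simp add: e_nth)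
  qed
  have coatoms_P: "coatoms ?P = (\<lambda>i. e i (c i)) ` {..<?n}"
  proof
    show "(\<lambda>i. e i (c i)) ` {..<?n} \<subseteq> coatoms ?P" using e_coatom by auto
    show "coatoms ?P \<subseteq> (\<lambda>i. e i (c i)) ` {..<?n}"
    proof
      fix m assume m: "m \<in> coatoms ?P"
      then have car: "m \<in> carrier ?P" and "m \<noteq> ?one" by (simp_all add: coatoms_def P_one)
      then obtain i where i: "i < ?n" "m ! i \<noteq> wone (Ws ! i)"
        using nth_equalityI[of m ?one] by (auto simp: carrier_direct_product)
      have "e i (c i) = m \<or> e i (c i) = ?one"
        using m below_e[OF i(1) car i(2)] e_car[OF i(1) c_car[OF i(1)]]
        by (simp add: coatoms_def P_one)
      moreover have "e i (c i) \<noteq> ?one" using e_coatom[OF i(1)] by (simp add: coatoms_def P_one)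
      ultimately show "m \<in> (\<lambda>i. e i (c i)) ` {..<?n}" using i by auto
    qed
  qed
  have card_block: "card (block ?P (e i (c i))) = card (carrier (Ws ! i))" if i: "i < ?n" for i
  proof -
    have "block ?P (e i (c i)) = e i ` carrier (Ws ! i)"
    proof
      show "block ?P (e i (c i)) \<subseteq> e i ` carrier (Ws ! i)"
      proof
        fix xs assume xs: "xs \<in> block ?P (e i (c i))"
        then have car: "xs \<in> carrier ?P" by (simp add: block_def)
        have "xs ! j = wone (Ws ! j)" if j: "j < ?n" "j \<noteq> i" for j
        proof (rule ccontr)
          assume "xs ! j \<noteq> wone (Ws ! j)"
          then have "e j (c j) = e i (c i)"
            using below_e[OF j(1) car] xs e_coatom[OF j(1)] by (simp add: block_def)
          then show False using inj i j by (auto simp: inj_on_def)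
        qed
        then have "xs = e i (xs ! i)"
          using car by (intro nth_equalityI) (simp_all add: carrier_direct_product len_e e_nth)
        moreover have "xs ! i \<in> carrier (Ws ! i)" using car i by (simp add: carrier_direct_product)
        ultimately show "xs \<in> e i ` carrier (Ws ! i)" by blast
      qed
      show "e i ` carrier (Ws ! i) \<subseteq> block ?P (e i (c i))"
      proof
        fix xs assume "xs \<in> e i ` carrier (Ws ! i)"
        then obtain x where x: "x \<in> carrier (Ws ! i)" "xs = e i x" by blast
        have "k = i" if k: "k < ?n" "wle ?P xs (e k (c k))" for k
        proof (rule ccontr)
          assume "k \<noteq> i"
          then have "wle (Ws ! k) (wone (Ws ! k)) (c k)"
            using k x(2) by (auto simp: wle_direct_product e_nth dest: spec[of _ k])
          then show False using one_le c_car c_ne k(1) by metis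
        qed
        then show "xs \<in> block ?P (e i (c i))"
          using e_car[OF i x(1)] x(2) by (auto simp: block_def coatoms_P)
      qed
    qed
    moreover have "inj_on (e i) (carrier (Ws ! i))"
    proof (rule inj_onI)
      fix x y assume "e i x = e i y"
      then have "e i x ! i = e i y ! i" by simp
      then show "x = y" using i by (simp add: e_nth)
    qed
    ultimately show ?thesis by (simp add: card_image)
  qed
  have "block_sizes ?P = image_mset (\<lambda>i. card (block ?P (e i (c i)))) (mset_set {..<?n})"
    unfolding block_sizes_def coatoms_P image_mset_mset_set[OF inj, symmetric]
    by (simp add: multiset.map_comp comp_def)
  also have "\<dots> = image_mset (\<lambda>i. card (carrier (Ws ! i))) (mset_set {..<?n})"
    by (intro image_mset_cong) (simp add: card_block)
  also have "\<dots> = mset (map (\<lambda>i. card (carrier (Ws ! i))) [0..<?n])"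
    by (simp only: mset_map mset_upt atLeast0LessThan)
  also have "map (\<lambda>i. card (carrier (Ws ! i))) [0..<?n] = map (\<lambda>W. card (carrier W)) Ws"
    by (intro nth_equalityI; simp)
  finally show ?thesis .
qed

section \<open>Isomorphism types and factorizations\<close>

text \<open>
  The values of \<open>block_sizes\<close> on the algebras of order \<open>n\<close>: besides the decompositions, the single
  factor \<open>n\<close> of a chain, which for \<open>n = 1\<close> gives way to the empty product.
\<close>
definition factorizations :: "nat \<Rightarrow> nat multiset set" where
  "factorizations n = {R. (\<forall>r\<in>#R. 1 < r) \<and> prod_mset R = n}"

lemma product_of_chains_factorization:
  assumes R: "R \<in> factorizations n" and C: "\<And>r. r \<in># R \<Longrightarrow> C r \<in> wajsberg_chains r"
  shows "product_of_chains C R \<in> wajsberg_algebras n"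
    and "block_sizes (product_of_chains C R) = R"
proof -
  let ?Ws = "map C (sorted_list_of_multiset R)"
  have W: "\<exists>r>1. W \<in> wajsberg_chains r" if "W \<in> set ?Ws" for W
    using that R C by (auto simp: factorizations_def)
  have sizes: "map (\<lambda>W. card (carrier W)) ?Ws = sorted_list_of_multiset R"
    using C by (auto simp: wajsberg_chainsD(3) comp_def intro!: map_idI)
  have R_eq: "mset (sorted_list_of_multiset R) = R" by simp
  have "wajsberg_algebra (direct_product ?Ws)"
    using W by (intro wajsberg_algebra_direct_product)
      (auto simp: wajsberg_chains_def wajsberg_algebras_def)
  moreover have "finite (carrier (direct_product ?Ws)) \<and>
      card (carrier (direct_product ?Ws)) = prod_list (sorted_list_of_multiset R)"
    using finite_card_direct_product[of ?Ws] W unfolding sizes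
    by (auto simp: wajsberg_chains_def wajsberg_algebras_def)
  moreover have "prod_list (sorted_list_of_multiset R) = n"
    using R by (simp add: factorizations_def flip: prod_mset_prod_list)
  ultimately show "product_of_chains C R \<in> wajsberg_algebras n"
    by (simp add: product_of_chains_def wajsberg_algebras_def)
  show "block_sizes (product_of_chains C R) = R"
    using block_sizes_direct_product[of ?Ws, OF W] unfolding product_of_chains_def sizes R_eq .
qed

lemma block_sizes_eq_imp_wiso:
  assumes V: "V \<in> wajsberg_algebras n" and W: "W \<in> wajsberg_algebras k"
    and eq: "block_sizes V = block_sizes W"
  shows "wiso V W \<noteq> {}"
proof -
  interpret V: finite_wajsberg_algebra V by (rule finite_wajsberg_algebraI[OF V])
  interpret W: finite_wajsberg_algebra W by (rule finite_wajsberg_algebraI[OF W])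
  have luk: "luk_chain r \<in> wajsberg_chains r" if "r \<in># block_sizes W" for r
    using W.block_sizes_gt_one[OF that] by (intro luk_chain_in_wajsberg_chains) simp
  obtain g h where g: "g \<in> wiso V (product_of_chains luk_chain (block_sizes W))"
    and h: "h \<in> wiso W (product_of_chains luk_chain (block_sizes W))"
    using V.wiso_product_of_chains[of luk_chain] W.wiso_product_of_chains[of luk_chain] luk eq by auto
  show ?thesis using wiso_comp[OF g wiso_inverse[OF W.wajsberg_algebra_axioms h]] by blast
qed

lemma block_sizes_in_factorizations:
  assumes W: "W \<in> wajsberg_algebras n"
  shows "block_sizes W \<in> factorizations n"
proof -
  interpret finite_wajsberg_algebra W by (rule finite_wajsberg_algebraI[OF W])
  let ?R = "block_sizes W"
  have gt: "\<forall>r\<in>#?R. 1 < r" using block_sizes_gt_one by blast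
  then have luk: "luk_chain r \<in> wajsberg_chains r" if "r \<in># ?R" for r
    using that by (intro luk_chain_in_wajsberg_chains) auto
  obtain h where h: "h \<in> wiso W (product_of_chains luk_chain ?R)"
    using wiso_product_of_chains[of luk_chain] luk by blast
  have "?R \<in> factorizations (prod_mset ?R)" using gt by (simp add: factorizations_def)
  then have "product_of_chains luk_chain ?R \<in> wajsberg_algebras (prod_mset ?R)"
    using luk by (rule product_of_chains_factorization)
  moreover have "card (carrier (product_of_chains luk_chain ?R)) = n"
    using bij_betw_same_card[OF wisoD(1)[OF h]] W by (simp add: wajsberg_algebras_def)
  ultimately have "prod_mset ?R = n" by (simp add: wajsberg_algebras_def)
  then show ?thesis using gt by (simp add: factorizations_def)
qed

text \<open>
  The construction \<open>transport\<close> with an arbitrary target type. Products of chains have lists as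
  elements, and this gives them copies on the natural numbers.
\<close>
definition image_algebra :: "('a \<Rightarrow> 'b) \<Rightarrow> 'a wajsberg \<Rightarrow> 'b wajsberg" where
  "image_algebra f W = (let g = inv_into (carrier W) f in
     \<lparr>carrier = f ` carrier W,
      wimp = (\<lambda>x y. f (g x \<triangleright>\<^bsub>W\<^esub> g y)),
      wneg = (\<lambda>x. f (wneg W (g x))),
      wone = f (wone W)\<rparr>)"

lemma image_algebra_wiso: "inj_on f (carrier W) \<Longrightarrow> f \<in> wiso W (image_algebra f W)"
  by (intro wisoI) (simp_all add: image_algebra_def Let_def inj_on_imp_bij_betw)

lemma wiso_wajsberg_algebras:
  assumes "V \<in> wajsberg_algebras n" and h: "h \<in> wiso V W"
  shows "W \<in> wajsberg_algebras n" and "block_sizes W = block_sizes V"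
  using assms wiso_wajsberg_algebra[OF _ h] block_sizes_wiso[OF _ h]
    bij_betw_finite[OF wisoD(1)[OF h]] bij_betw_same_card[OF wisoD(1)[OF h]]
  by (auto simp: wajsberg_algebras_def)

lemma wajsberg_nonchains_iff:
  "W \<in> wajsberg_nonchains n \<longleftrightarrow> W \<in> wajsberg_algebras n \<and> 1 < size (block_sizes W)"
  using finite_wajsberg_algebra.wtotal_iff_size_block_sizes[OF finite_wajsberg_algebraI]
  by (auto simp: wajsberg_nonchains_def not_le[symmetric])

lemma wajsberg_chains_iff:
  "W \<in> wajsberg_chains n \<longleftrightarrow> W \<in> wajsberg_algebras n \<and> size (block_sizes W) \<le> 1"
  using finite_wajsberg_algebra.wtotal_iff_size_block_sizes[OF finite_wajsberg_algebraI]
  by (auto simp: wajsberg_chains_def)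

lemma block_sizes_image:
  "block_sizes ` (wajsberg_algebras n :: nat wajsberg set) = factorizations n"
proof
  show "block_sizes ` (wajsberg_algebras n :: nat wajsberg set) \<subseteq> factorizations n"
    using block_sizes_in_factorizations by auto
  show "factorizations n \<subseteq> block_sizes ` (wajsberg_algebras n :: nat wajsberg set)"
  proof
    fix R assume R: "R \<in> factorizations n"
    let ?P = "product_of_chains luk_chain R"
    have luk: "luk_chain r \<in> wajsberg_chains r" if "r \<in># R" for r
      using that R by (intro luk_chain_in_wajsberg_chains) (auto simp: factorizations_def)
    have "finite (carrier ?P)"
      using product_of_chains_factorization(1)[OF R luk] by (simp add: wajsberg_algebras_def)
    then obtain g :: "nat list \<Rightarrow> nat" where "inj_on g (carrier ?P)"
      using finite_imp_inj_to_nat_seg by blast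
    then have f: "g \<in> wiso ?P (image_algebra g ?P)" by (rule image_algebra_wiso)
    have "image_algebra g ?P \<in> wajsberg_algebras n" "block_sizes (image_algebra g ?P) = R"
      using wiso_wajsberg_algebras[OF product_of_chains_factorization(1)[OF R luk] f]
        product_of_chains_factorization(2)[OF R luk] by simp_all
    then show "R \<in> block_sizes ` (wajsberg_algebras n :: nat wajsberg set)"
      by (intro image_eqI[of _ _ "image_algebra g ?P"]) simp_all
  qed
qed

text \<open>
  Isomorphism is equality of block sizes, so each class is a fibre of \<open>block_sizes\<close>.
\<close>
lemma card_iso_types:
  assumes S: "S \<subseteq> wajsberg_algebras n"
  shows "card (iso_types S) = card (block_sizes ` S)"
proof -
  have "wiso V W \<noteq> {} \<longleftrightarrow> block_sizes V = block_sizes W" if "V \<in> S" "W \<in> S" for V W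
  proof
    assume "wiso V W \<noteq> {}"
    then obtain h where "h \<in> wiso V W" by blast
    then show "block_sizes V = block_sizes W"
      using wiso_wajsberg_algebras(2)[of V n h W] that(1) S by auto
  next
    have "V \<in> wajsberg_algebras n" "W \<in> wajsberg_algebras n" using that S by auto
    then show "block_sizes V = block_sizes W \<Longrightarrow> wiso V W \<noteq> {}"
      by (rule block_sizes_eq_imp_wiso)
  qed
  then have rel: "{(V, W). V \<in> S \<and> W \<in> S \<and> wiso V W \<noteq> {}} =
      {(V, W). V \<in> S \<and> W \<in> S \<and> block_sizes V = block_sizes W}"
    by blast
  have "iso_types S = (\<lambda>R. {W \<in> S. R = block_sizes W}) ` block_sizes ` S"
    unfolding iso_types_def rel quotient_def image_image by auto
  moreover have "inj_on (\<lambda>R. {W \<in> S. R = block_sizes W}) (block_sizes ` S)"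
    by (rule inj_onI) blast
  ultimately show ?thesis by (simp only: card_image)
qed

text \<open>
  A single factor equals the product, while one of several factors greater than \<open>1\<close> is less than it.
\<close>
lemma decompositions_eq:
  assumes n: "1 \<le> n"
  shows "decompositions n = {R \<in> factorizations n. 1 < size R}"
proof (intro equalityI subsetI)
  fix R assume R: "R \<in> decompositions n"
  have "size R \<noteq> 0" using R by (auto simp: decompositions_def)
  moreover have "size R \<noteq> 1"
  proof
    assume "size R = 1"
    then obtain r where "R = {#r#}" using size_1_singleton_mset by blast
    then show False using R by (auto simp: decompositions_def)
  qed
  ultimately have "1 < size R" by linarith
  then show "R \<in> {R \<in> factorizations n. 1 < size R}"
    using R by (auto simp: decompositions_def factorizations_def)
next
  fix R assume "R \<in> {R \<in> factorizations n. 1 < size R}"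
  then have R: "\<forall>r\<in>#R. 1 < r" "prod_mset R = n" "1 < size R" by (auto simp: factorizations_def)
  have "r < n" if r: "r \<in># R" for r
  proof -
    obtain R' where R': "R = add_mset r R'" using r by (metis insert_DiffM)
    then obtain s where s: "s \<in># R'" using R(3) by fastforce
    have "0 < prod_mset R'" using R(1) R' by (auto intro!: gr0I)
    then have "s \<le> prod_mset R'" by (intro dvd_imp_le dvd_prod_mset s)
    then have "1 < prod_mset R'" using R(1) R' s by auto
    then show ?thesis using R(1,2) R' by auto
  qed
  then show "R \<in> decompositions n" using R by (auto simp: decompositions_def)
qed

lemma factorizations_size_le_1:
  assumes n: "1 \<le> n"
  shows "{R \<in> factorizations n. size R \<le> 1} = {if n = 1 then {#} else {#n#}}"
proof -
  have "R = (if n = 1 then {#} else {#n#})" if "R \<in> factorizations n" "size R \<le> 1" for R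
  proof -
    from that(2) consider "R = {#}" | r where "R = {#r#}"
      using size_1_singleton_mset[of R] by (cases "size R = 0") auto
    then show ?thesis using that(1) by cases (auto simp: factorizations_def)
  qed
  then show ?thesis using n by (auto simp: factorizations_def)
qed

text \<open>
  All factors are at least \<open>2\<close>, so there are fewer of them than their product.
\<close>
lemma finite_factorizations:
  assumes n: "1 \<le> n"
  shows "finite (factorizations n)"
proof (rule finite_subset)
  have size_le: "size R < prod_mset R" if "\<forall>r\<in>#R. 1 < r" for R :: "nat multiset"
    using that
  proof (induction R)
    case (add r R)
    then have "size R < prod_mset R" "2 \<le> r" by auto
    then have "Suc (size R) < 2 * prod_mset R" by simp
    also have "\<dots> \<le> r * prod_mset R" using \<open>2 \<le> r\<close> by (rule mult_le_mono1)
    finally show ?case by simp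
  qed simp
  show "factorizations n \<subseteq> mset ` {xs. set xs \<subseteq> {..n} \<and> length xs \<le> n}"
  proof
    fix R assume R: "R \<in> factorizations n"
    have "r \<le> n" if "r \<in># R" for r
      using that R n by (intro dvd_imp_le) (auto simp: factorizations_def intro: dvd_prod_mset)
    moreover have "size R \<le> n" using R size_le[of R] by (auto simp: factorizations_def)
    moreover obtain xs where "R = mset xs" using ex_mset by metis
    ultimately show "R \<in> mset ` {xs. set xs \<subseteq> {..n} \<and> length xs \<le> n}" by auto
  qed
  show "finite (mset ` {xs. set xs \<subseteq> {..n} \<and> length xs \<le> n})"
    by (intro finite_imageI finite_lists_length_le) simp
qed

section \<open>Relabellings and the total number\<close>

text \<open>
  The least and greatest elements are \<open>0\<close> and \<open>1\<close>, which differ, so a relabelling is a permutation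
  of the \<open>n - 2\<close> other elements.
\<close>
lemma card_relabellings:
  assumes W: "W \<in> wajsberg_algebras n" and n: "2 \<le> n"
  shows "card (relabellings W) = fact (n - 2)"
    and "f \<in> relabellings W \<Longrightarrow> f permutes carrier W"
proof -
  interpret finite_wajsberg_algebra W by (rule finite_wajsberg_algebraI[OF W])
  have least: "wleast W x \<longleftrightarrow> x = wneg W (wone W)" for x
  proof
    assume "wleast W x"
    then have "x \<in> carrier W" "wle W x (wneg W (wone W))" by (auto simp: wleast_def closed)
    then show "x = wneg W (wone W)"
      using below_antisym[of x] zero_below[of x] closed by (simp add: wle_def)
  qed (auto simp: wleast_def wle_def closed zero_below)
  have greatest: "wgreatest W x \<longleftrightarrow> x = wone W" for x
    using one_below[of x] by (auto simp: wgreatest_def wle_def closed below_one)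
  have card: "card (carrier W) = n" using W by (simp add: wajsberg_algebras_def)
  have ne: "wneg W (wone W) \<noteq> wone W"
  proof
    assume eq: "wneg W (wone W) = wone W"
    have "x = wone W" if "x \<in> carrier W" for x
      using one_below[of x] zero_below[OF that] that by (simp add: eq)
    then have "carrier W \<subseteq> {wone W}" by blast
    then have "card (carrier W) \<le> card {wone W}" by (rule card_mono[rotated]) simp
    then show False using card n by simp
  qed
  let ?S = "carrier W - {wneg W (wone W), wone W}"
  have "relabellings W = {f. f permutes ?S}"
  proof (intro equalityI subsetI)
    fix f assume "f \<in> relabellings W"
    then have f: "f permutes carrier W" "f (wneg W (wone W)) = wneg W (wone W)" "f (wone W) = wone W"
      by (auto simp: relabellings_def least greatest)
    then have "f permutes ?S" by (intro permutes_superset[OF f(1)]) auto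
    then show "f \<in> {f. f permutes ?S}" by simp
  next
    fix f assume "f \<in> {f. f permutes ?S}"
    then have "f permutes ?S" by simp
    then show "f \<in> relabellings W"
      by (auto simp: relabellings_def least greatest permutes_not_in intro: permutes_subset)
  qed
  moreover have "card ?S = n - 2"
    using ne card finite_carrier by (subst card_Diff_subset) (auto simp: closed)
  ultimately show "card (relabellings W) = fact (n - 2)"
    using finite_carrier by (simp add: card_permutations)
  show "f \<in> relabellings W \<Longrightarrow> f permutes carrier W" by (simp add: relabellings_def)
qed

theorem proposition4p2:
  fixes n :: nat and C :: "nat \<Rightarrow> 'a wajsberg"
  assumes "n \<ge> 1"
    and "\<And>r. 1 < r \<Longrightarrow> r < n \<Longrightarrow> C r \<in> wajsberg_chains r"
  shows "card (iso_types (wajsberg_nonchains n)) = num_decompositions n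
       \<and> card (iso_types (wajsberg_algebras n)) = num_decompositions n + 1
       \<and> (n \<ge> 4 \<and> \<not> prime n \<longrightarrow> total_number C n = num_decompositions n * fact (n - 2) + 1)"
proof (intro conjI impI)
  note n = \<open>n \<ge> 1\<close>
  have finite_dec: "finite (decompositions n)"
    unfolding decompositions_eq[OF n] using finite_factorizations[OF n] by simp
  have "block_sizes ` (wajsberg_nonchains n :: nat wajsberg set) = decompositions n"
    unfolding decompositions_eq[OF n] block_sizes_image[symmetric]
    by (auto simp: wajsberg_nonchains_iff)
  then show "card (iso_types (wajsberg_nonchains n)) = num_decompositions n"
    by (subst card_iso_types[of _ n]) (auto simp: wajsberg_nonchains_iff num_decompositions_def)
  have "factorizations n = decompositions n \<union> {R \<in> factorizations n. size R \<le> 1}"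
    unfolding decompositions_eq[OF n] by auto
  moreover have "decompositions n \<inter> {R \<in> factorizations n. size R \<le> 1} = {}"
    unfolding decompositions_eq[OF n] by auto
  ultimately have "card (factorizations n) = num_decompositions n + 1"
    using finite_dec factorizations_size_le_1[OF n]
    by (metis num_decompositions_def card_Un_disjoint finite.intros is_singletonI is_singleton_altdef)
  then show "card (iso_types (wajsberg_algebras n)) = num_decompositions n + 1"
    by (simp add: card_iso_types[OF subset_refl] block_sizes_image)
  assume "n \<ge> 4 \<and> \<not> prime n"
  then have n2: "2 \<le> n" by simp
  have "block_sizes ` (wajsberg_chains n :: nat wajsberg set) = {R \<in> factorizations n. size R \<le> 1}"
    unfolding block_sizes_image[symmetric] by (auto simp: wajsberg_chains_iff)
  then have chains: "card (iso_types (wajsberg_chains n)) = 1"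
    unfolding factorizations_size_le_1[OF n]
    by (subst card_iso_types[of _ n]) (auto simp: wajsberg_chains_iff)
  have C: "C r \<in> wajsberg_chains r" if "R \<in> decompositions n" "r \<in># R" for R r
    using that assms(2) by (auto simp: decompositions_def)
  have P: "product_of_chains C R \<in> wajsberg_algebras n"
      "block_sizes (product_of_chains C R) = R" "1 < size R" if R: "R \<in> decompositions n" for R
    using product_of_chains_factorization[OF _ C[OF R]] R unfolding decompositions_eq[OF n] by auto
  have "transport f (product_of_chains C R) \<in> wajsberg_nonchains n"
    if R: "R \<in> decompositions n" and f: "f \<in> relabellings (product_of_chains C R)" for R f
  proof -
    have "f permutes carrier (product_of_chains C R)"
      by (rule card_relabellings(2)[OF P(1)[OF R] n2 f])
    then have "f \<in> wiso (product_of_chains C R) (image_algebra f (product_of_chains C R))"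
      by (intro image_algebra_wiso) (simp add: permutes_inj_on)
    note image = wiso_wajsberg_algebras[OF P(1)[OF R] this]
    have "transport f (product_of_chains C R) = image_algebra f (product_of_chains C R)"
      by (simp add: transport_def image_algebra_def)
    then show ?thesis using image P(2,3)[OF R] by (simp add: wajsberg_nonchains_iff)
  qed
  then have "relabelled_products C n =
      (SIGMA R:decompositions n. relabellings (product_of_chains C R))"
    by (auto simp: relabelled_products_def)
  moreover have "finite (relabellings (product_of_chains C R))" if "R \<in> decompositions n" for R
    using card_relabellings(1)[OF P(1)[OF that] n2] by (simp add: card_ge_0_finite)
  ultimately have "card (relabelled_products C n) =
      (\<Sum>R\<in>decompositions n. card (relabellings (product_of_chains C R)))"
    using finite_dec by simp
  also have "\<dots> = num_decompositions n * fact (n - 2)"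
    using card_relabellings(1)[OF P(1) n2] by (simp add: num_decompositions_def)
  finally show "total_number C n = num_decompositions n * fact (n - 2) + 1"
    by (simp add: total_number_def chains)
qed

end
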